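(* Let $\phi\in\mathbb{R}[x_1,\dots,x_4]$ be a unimodular Hessian potential of index $1$. Assume that $$\phi=\phi_d+\phi_{d-1}+\cdots+\phi_{d-k}+\phi_2+\phi_1+\phi_0,$$ where $\phi_j$ denotes the homogeneous piece of $\phi$ of degree $j$, and where $k,d$ are integers with $k\geq0$ and $d\geq4k+3$. Then $\phi$ admits a constant pivot.
   Context: A polynomial $\phi\in\mathbb{R}[x_1,\dots,x_n]$ is a unimodular Hessian potential of index $q$ if $\det(\operatorname{Hess}(\phi))$ is the constant polynomial $1$ or the constant polynomial $-1$, and the symmetric matrix $\operatorname{Hess}(\phi)_x$ has index $q$ (i.e. exactly $q$ negative eigenvalues, counted with multiplicity) at every $x\in\mathbb{R}^n$. A constant pivot for $\phi$ is a nonzero constant vector $\xi\in\mathbb{R}^n$ such that the second directional derivative $D_\xi^2\phi=\langle\operatorname{Hess}(\phi)\xi,\xi\rangle$ is a constant function. *)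

theory Defs
  imports "HOL-Analysis.Analysis" "HOL-Library.Poly_Mapping"
    "HOL-Computational_Algebra.Polynomial"
begin

text \<open>
  Real polynomials in the variables \<open>x\<^sub>i\<close>, where \<open>i\<close> ranges over the finite type \<open>'n\<close>, are
  finitely supported maps from exponent vectors to coefficients; the ring structure is
  the convolution one of \<^theory>\<open>HOL-Library.Poly_Mapping\<close>.
\<close>

type_synonym 'n rpoly = "('n \<Rightarrow>\<^sub>0 nat) \<Rightarrow>\<^sub>0 real"

definition eval_rpoly :: "'n::finite rpoly \<Rightarrow> real ^ 'n \<Rightarrow> real" where
  "eval_rpoly p x = (\<Sum>m \<in> Poly_Mapping.keys p.
     Poly_Mapping.lookup p m * (\<Prod>i\<in>UNIV. (x $ i) ^ Poly_Mapping.lookup m i))"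

text \<open>
  In the next definition subtraction of exponent vectors truncates at \<open>0\<close>; this only happens when
  \<open>m\<close> has exponent \<open>0\<close> at \<open>i\<close>, and then the coefficient is \<open>0\<close>.
\<close>

definition partial_deriv :: "'n \<Rightarrow> 'n rpoly \<Rightarrow> 'n rpoly" where
  "partial_deriv i p =
     (\<Sum>m \<in> Poly_Mapping.keys p. Poly_Mapping.single (m - Poly_Mapping.single i 1)
                       (real (Poly_Mapping.lookup m i) * Poly_Mapping.lookup p m))"

definition total_deg :: "('n::finite \<Rightarrow>\<^sub>0 nat) \<Rightarrow> nat" where
  "total_deg m = (\<Sum>i\<in>UNIV. Poly_Mapping.lookup m i)"

definition hom_piece :: "nat \<Rightarrow> 'n::finite rpoly \<Rightarrow> 'n rpoly" where
  "hom_piece j p =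
     (\<Sum>m \<in> {m \<in> Poly_Mapping.keys p. total_deg m = j}.
        Poly_Mapping.single m (Poly_Mapping.lookup p m))"

definition hessian :: "'n::finite rpoly \<Rightarrow> 'n rpoly ^ 'n ^ 'n" where
  "hessian p = (\<chi> i j. partial_deriv i (partial_deriv j p))"

definition hessian_at :: "'n::finite rpoly \<Rightarrow> real ^ 'n \<Rightarrow> real ^ 'n ^ 'n" where
  "hessian_at p x = (\<chi> i j. eval_rpoly (hessian p $ i $ j) x)"

definition charpoly :: "real ^ 'n ^ 'n \<Rightarrow> real poly" where
  "charpoly A = det (\<chi> i j. (if i = j then [:0, 1:] else 0) - [:A $ i $ j:])"

text \<open>
  The number of negative eigenvalues, counted with algebraic multiplicity (which is the same as
  geometric multiplicity for the symmetric matrices considered here).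
\<close>

definition matrix_index :: "real ^ 'n ^ 'n \<Rightarrow> nat" where
  "matrix_index A = (\<Sum>l | l < 0 \<and> poly (charpoly A) l = 0. order l (charpoly A))"

definition unimodular_hessian_potential :: "'n::finite rpoly \<Rightarrow> nat \<Rightarrow> bool" where
  "unimodular_hessian_potential p q \<longleftrightarrow>
     (det (hessian p) = 1 \<or> det (hessian p) = - 1) \<and>
     (\<forall>x. matrix_index (hessian_at p x) = q)"

definition constant_pivot :: "'n::finite rpoly \<Rightarrow> real ^ 'n \<Rightarrow> bool" where
  "constant_pivot p v \<longleftrightarrow>
     v \<noteq> 0 \<and> (\<exists>c. \<forall>x. (hessian_at p x *v v) \<bullet> v = c)"

end

theory Submission
  imports Defs
begin

text \<open>
  Let \<open>A\<close> be the Hessian of \<open>\<phi>\<close> at the origin, \<open>S(x)\<close> the Hessian at \<open>x\<close> minus \<open>A\<close>, and let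
  \<open>N(x) = A\<^sup>-\<^sup>1 S(x)\<close>, which is self-adjoint for the bilinear form \<open>g(p, q) = p \<bullet> A q\<close>. A constant pivot
  is a nonzero vector \<open>\<xi>\<close> with \<open>g(N(x) \<xi>, \<xi>) = 0\<close> for all \<open>x\<close>.

  The gap between the degree \<open>2\<close> and the degrees \<open>d - k, ..., d\<close> makes \<open>N(x)\<close> nilpotent. For the Hessian at
  \<open>r x\<close> is \<open>A + r\<^sup>m R(r)\<close> with \<open>m = d - k - 2\<close> and \<open>R\<close> of degree at most \<open>k\<close> in \<open>r\<close>, and in the expansion of
  its determinant the terms of order \<open>j\<close> in \<open>R\<close> have degrees in \<open>r\<close> between \<open>m j\<close> and \<open>m j + k j\<close>. By
  \<open>d \<ge> 4 k + 3\<close> these ranges are disjoint, so constancy of the determinant forces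
  \<open>det (A + t S(x)) = det A\<close> for all \<open>t\<close> (\<open>det_pencil_constant\<close>), which is nilpotency
  (\<open>nilpotent_of_det_pencil_constant\<close>).

  As the index is \<open>1\<close>, the form \<open>g\<close> is Lorentzian. There a totally isotropic subspace is at most a
  line, and therefore \<open>N(x)\<close> has cube zero (\<open>cube_eq_0\<close>), and when it is nonzero there is a null
  vector \<open>v\<close> such that the form \<open>g(N(x) p, q)\<close> vanishes on the hyperplane orthogonal to \<open>v\<close>. With \<open>e\<close> a fixed
  timelike vector, \<open>v\<close> can be taken to be \<open>N(x)\<^sup>2 e\<close>, or \<open>N(x) e\<close> if \<open>N\<^sup>2\<close> vanishes identically; so \<open>v\<close> is
  polynomial in \<open>x\<close>. The symmetry of third derivatives implies that the direction of \<open>v\<close> does not change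
  when \<open>x\<close> moves orthogonally to \<open>v\<close> (\<open>null_field_square\<close>, \<open>null_field_linear\<close>). Hence \<open>\<phi>\<close> minus its
  quadratic part is affine on the null hyperplane through \<open>x\<close> orthogonal to \<open>v(x)\<close>
  (\<open>flat_hyperplane_through_null_field\<close>): generic points carry flat null hyperplanes.

  That one direction serves everywhere has a global reason (\<open>null_direction_exists\<close>). Two flat null
  hyperplanes with different directions intersect, and \<open>N\<close> vanishes on the intersection. If there were
  infinitely many directions, one flat hyperplane would be cut by infinitely many others in different
  subsets, and the polynomial \<open>N\<close> would vanish at all its points, but it can be chosen through a point
  with \<open>N \<noteq> 0\<close>. So infinitely many parallel flat hyperplanes share one direction \<open>\<xi>\<close>, and again
  since \<open>N\<close> is polynomial, \<open>g(N(x) \<xi>, \<xi>) = 0\<close> everywhere.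
\<close>

section \<open>Self-adjoint nilpotent endomorphisms of a Lorentzian form\<close>

text \<open>
  The last condition is the only trace of the signature: a nondegenerate form that is positive
  definite on the orthogonal complement of one vector has at most one negative direction. When
  \<open>e\<close> is timelike this is a Lorentzian form, and \<open>e\<close> serves as an observer: \<open>g p e\<close> is the time
  component of \<open>p\<close>, by which null vectors can be normalized.
\<close>

locale lorentz_form =
  fixes g :: "'a::euclidean_space \<Rightarrow> 'a \<Rightarrow> real" and e :: 'a
  assumes bilinear: "bilinear g"
    and sym: "g p q = g q p"
    and nondegenerate: "(\<And>q. g p q = 0) \<Longrightarrow> p = 0"
    and pos: "g w e = 0 \<Longrightarrow> w \<noteq> 0 \<Longrightarrow> g w w > 0"
begin

lemmas g_simps = bilinear_ladd[OF bilinear] bilinear_radd[OF bilinear]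
  bilinear_lmul[OF bilinear] bilinear_rmul[OF bilinear]
  bilinear_lsub[OF bilinear] bilinear_rsub[OF bilinear]
  bilinear_lzero[OF bilinear] bilinear_rzero[OF bilinear]
  bilinear_lneg[OF bilinear] bilinear_rneg[OF bilinear]

lemma null_orthogonal_base_eq_0: "g p p = 0 \<Longrightarrow> g p e = 0 \<Longrightarrow> p = 0"
  using pos by force

text \<open>
  Scaling the two vectors to the same time component, their difference is null and orthogonal to
  \<open>e\<close>, hence zero. So a totally isotropic subspace is at most a line; everything below about
  nilpotent endomorphisms comes from this.
\<close>

lemma orthogonal_nulls_parallel:
  assumes "g p p = 0" "g q q = 0" "g p q = 0" "q \<noteq> 0"
  shows "p = (g p e / g q e) *\<^sub>R q"
proof -
  have nz: "g q e \<noteq> 0"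
    using assms null_orthogonal_base_eq_0 by blast
  define z where "z = g q e *\<^sub>R p - g p e *\<^sub>R q"
  have "g z e = 0"
    by (simp add: z_def g_simps)
  moreover have "g z z = 0"
    using assms sym[of q p] by (simp add: z_def g_simps)
  ultimately have "z = 0"
    by (rule null_orthogonal_base_eq_0[rotated])
  then show ?thesis
    using nz by (simp add: z_def field_simps eq_vector_fraction_iff)
qed

end

locale selfadjoint_nilpotent = lorentz_form g e for g :: "'a::euclidean_space \<Rightarrow> 'a \<Rightarrow> real" and e :: 'a +
  fixes N :: "'a \<Rightarrow> 'a"
  assumes linear_N: "linear N"
    and selfadjoint: "g (N p) q = g p (N q)"
    and nilpotent: "\<exists>k. (N ^^ k) p = 0"
begin

lemmas N_simps = linear_add[OF linear_N] linear_diff[OF linear_N] linear_scale[OF linear_N]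
  linear_0[OF linear_N]

lemma selfadjoint_power: "g ((N ^^ k) p) q = g p ((N ^^ k) q)"
  by (induction k arbitrary: p q) (simp_all add: selfadjoint funpow_swap1)

lemma inner_powers: "g ((N ^^ i) p) ((N ^^ j) p) = g p ((N ^^ (i + j)) p)"
  by (simp add: selfadjoint_power funpow_add)

text \<open>
  In a Jordan chain of length \<open>k \<ge> 4\<close> the last two vectors \<open>a\<close> and \<open>N a\<close> would span a totally isotropic
  plane, because \<open>g (N\<^sup>i p) (N\<^sup>j p) = g p (N\<^sup>i\<^sup>+\<^sup>j p)\<close> vanishes once \<open>i + j \<ge> k\<close>.
\<close>

lemma cube_eq_0: "N (N (N p)) = 0"
proof -
  define k where "k = (LEAST k. (N ^^ k) p = 0)"
  have k: "(N ^^ k) p = 0" and least: "\<And>j. (N ^^ j) p = 0 \<Longrightarrow> k \<le> j"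
    unfolding k_def using nilpotent by (auto intro: LeastI_ex Least_le)
  have beyond: "(N ^^ j) p = 0" if "k \<le> j" for j
    using that
  proof (induction j rule: dec_induct)
    case (step j)
    then show ?case by (simp add: N_simps)
  qed (fact k)
  have "k \<le> 3"
  proof (rule ccontr)
    assume "\<not> k \<le> 3"
    then obtain i where i: "k = i + 4"
      using le_Suc_ex[of 4 k] by (auto simp: add.commute)
    define a b where "a = (N ^^ (i + 2)) p" and "b = (N ^^ (i + 3)) p"
    have ba: "b = N a" by (simp add: a_def b_def eval_nat_numeral)
    have "g a a = 0" "g a b = 0" "g b b = 0"
      unfolding a_def b_def inner_powers using i by (simp_all only: beyond g_simps)
    moreover have "b \<noteq> 0"
      using least[of "i + 3"] i by (auto simp: b_def)
    ultimately obtain c where c: "a = c *\<^sub>R b"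
      using orthogonal_nulls_parallel by blast
    have "b = N (c *\<^sub>R b)"
      using ba unfolding c[symmetric] .
    also have "\<dots> = c *\<^sub>R N b"
      by (simp add: N_simps)
    also have "N b = (N ^^ k) p"
      by (simp add: b_def i eval_nat_numeral)
    finally show False
      using k \<open>b \<noteq> 0\<close> by simp
  qed
  from beyond[OF this] show ?thesis
    by (simp add: eval_nat_numeral)
qed

text \<open>
  The images of \<open>N\<^sup>2\<close>, and of \<open>N\<close> when \<open>N\<^sup>2 = 0\<close>, are totally isotropic, and a null vector orthogonal
  to \<open>e\<close> is zero. Thus the highest nonzero power of \<open>N\<close> is already detected by its value at \<open>e\<close>.
  This gives a null vector depending polynomially on \<open>N\<close>.
\<close>

lemma square_eq_0_of_base:
  assumes "N (N e) = 0"
  shows "N (N p) = 0"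
  by (rule null_orthogonal_base_eq_0) (simp_all add: selfadjoint cube_eq_0 assms g_simps N_simps)

lemma eq_0_of_base:
  assumes "\<And>q. N (N q) = 0" and "N e = 0"
  shows "N p = 0"
  by (rule null_orthogonal_base_eq_0) (simp_all add: selfadjoint assms g_simps)

text \<open>
  The quadratic form \<open>g (N p) p\<close> is, in this case, a product of two linear forms, one of which is
  \<open>g v\<close> with \<open>v = N\<^sup>2 e\<close>. To see that it vanishes on the complement of \<open>v\<close>, note that for \<open>p\<close> orthogonal
  to \<open>v\<close> the vector \<open>N p\<close> is null and orthogonal to \<open>v\<close>, so it is a multiple of \<open>v\<close>.
\<close>

lemma vanish_on_perp_square:
  assumes v: "N (N e) \<noteq> 0" and p: "g (N (N e)) p = 0" and q: "g (N (N e)) q = 0"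
  shows "g (N p) q = 0"
proof -
  let ?v = "N (N e)"
  have vv: "g ?v ?v = 0"
    by (simp add: selfadjoint cube_eq_0 g_simps N_simps)
  obtain c where c: "N (N p) = c *\<^sub>R ?v"
    using orthogonal_nulls_parallel[OF _ vv _ v, of "N (N p)"]
    by (auto simp: selfadjoint cube_eq_0 g_simps N_simps)
  have "g (N p) (N p) = g (N (N p)) p"
    by (simp add: selfadjoint)
  also have "\<dots> = 0"
    by (simp add: c g_simps p)
  finally obtain c' where "N p = c' *\<^sub>R ?v"
    using orthogonal_nulls_parallel[OF _ vv _ v, of "N p"]
    by (auto simp: selfadjoint cube_eq_0 g_simps N_simps)
  then show ?thesis
    by (simp add: g_simps q)
qed

lemma vanish_on_perp_linear:
  assumes sq: "\<And>p. N (N p) = 0"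
    and v: "N e \<noteq> 0" and q: "g (N e) q = 0"
  shows "g (N p) q = 0"
proof -
  obtain c where "N p = c *\<^sub>R N e"
    using orthogonal_nulls_parallel[OF _ _ _ v, of "N p"]
    by (auto simp: selfadjoint sq g_simps)
  then show ?thesis
    by (simp add: g_simps q)
qed

text \<open>
  Each of the two vanishing conditions says that \<open>N\<close> maps the hyperplane orthogonal to \<open>\<xi>\<close> (or \<open>\<eta>\<close>) into the
  line of that vector, and nilpotency then gives \<open>N \<xi> = 0\<close> and \<open>N \<eta> = 0\<close>. On the intersection of the two
  hyperplanes the image of \<open>N\<close> lies in both lines, so it is zero; \<open>\<xi>\<close>, \<open>\<eta>\<close> and this intersection
  span the space.
\<close>

lemma eq_0_of_two_nulls:
  assumes xi: "g \<xi> \<xi> = 0" "g \<xi> e = 1" and et: "g \<eta> \<eta> = 0" "g \<eta> e = 1"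
    and ne: "\<xi> \<noteq> \<eta>"
    and vxi: "\<And>p q. g \<xi> p = 0 \<Longrightarrow> g \<xi> q = 0 \<Longrightarrow> g (N p) q = 0"
    and vet: "\<And>p q. g \<eta> p = 0 \<Longrightarrow> g \<eta> q = 0 \<Longrightarrow> g (N p) q = 0"
  shows "N q = 0"
proof -
  have image: "N p = g (N p) e *\<^sub>R \<zeta>"
    if z: "g \<zeta> e = 1" and p: "g \<zeta> p = 0"
      and van: "\<And>p q. g \<zeta> p = 0 \<Longrightarrow> g \<zeta> q = 0 \<Longrightarrow> g (N p) q = 0" for \<zeta> p
  proof -
    \<comment> \<open>Every \<open>q\<close> lies in the complement of \<open>\<zeta>\<close> after subtracting a multiple of \<open>e\<close>.\<close>
    have "g (N p - g (N p) e *\<^sub>R \<zeta>) q = 0" for q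
    proof -
      have "g (N p) (q - g \<zeta> q *\<^sub>R e) = 0"
        by (rule van[OF p]) (simp add: g_simps z)
      then show ?thesis
        by (simp add: g_simps)
    qed
    from nondegenerate[OF this] show ?thesis by simp
  qed
  have kernel: "N \<zeta> = 0"
    if z: "g \<zeta> e = 1" "g \<zeta> \<zeta> = 0"
      and van: "\<And>p q. g \<zeta> p = 0 \<Longrightarrow> g \<zeta> q = 0 \<Longrightarrow> g (N p) q = 0" for \<zeta>
  proof -
    define c where "c = g (N \<zeta>) e"
    have c: "N \<zeta> = c *\<^sub>R \<zeta>"
      unfolding c_def by (rule image) (use that in auto)
    have "N (N (N \<zeta>)) = (c * c * c) *\<^sub>R \<zeta>"
      by (simp add: c N_simps)
    moreover have "\<zeta> \<noteq> 0"
      using z by (auto simp: g_simps)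
    ultimately have "c = 0"
      by (simp add: cube_eq_0)
    then show ?thesis
      by (simp add: c)
  qed
  have Nxi: "N \<xi> = 0" and Net: "N \<eta> = 0"
    by (rule kernel; use xi et vxi vet in auto)+
  define \<gamma> where "\<gamma> = g \<xi> \<eta>"
  have "\<gamma> \<noteq> 0"
  proof
    assume "\<gamma> = 0"
    moreover have "\<eta> \<noteq> 0"
      using et by (auto simp: g_simps)
    ultimately show False
      using orthogonal_nulls_parallel[OF xi(1) et(1)] ne xi et by (simp add: \<gamma>_def)
  qed
  define r where "r = q - (g q \<eta> / \<gamma>) *\<^sub>R \<xi> - (g q \<xi> / \<gamma>) *\<^sub>R \<eta>"
  have r: "g \<xi> r = 0" "g \<eta> r = 0"
    using \<open>\<gamma> \<noteq> 0\<close> xi et sym[of q] sym[of \<eta> \<xi>] by (simp_all add: r_def g_simps flip: \<gamma>_def)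
  have xi_multiple: "N r = g (N r) e *\<^sub>R \<xi>"
    by (rule image[OF xi(2) r(1)]) (rule vxi)
  have "N r = g (N r) e *\<^sub>R \<eta>"
    by (rule image[OF et(2) r(2)]) (rule vet)
  from trans[OF xi_multiple[symmetric] this] have "g (N r) e = 0"
    using ne by simp
  with xi_multiple have "N r = 0"
    by simp
  then show ?thesis
    by (simp add: r_def N_simps Nxi Net)
qed

end

section \<open>Polynomial functions of one real variable\<close>

lemma real_polynomial_function_poly:
  fixes f :: "real \<Rightarrow> real"
  assumes "real_polynomial_function f"
  obtains P where "f = poly P"
proof -
  obtain a n where "f = (\<lambda>x. \<Sum>i\<le>n. a i * x ^ i)"
    using real_polynomial_function_imp_sum[OF assms] by blast
  then have "f = poly (\<Sum>i\<le>n. monom (a i) i)"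
    by (simp add: fun_eq_iff poly_sum poly_monom)
  then show thesis by (rule that)
qed

lemma real_polynomial_function_eq_0_if_infinite:
  fixes f :: "real \<Rightarrow> real"
  assumes "real_polynomial_function f" and "infinite {s. f s = 0}"
  shows "f s = 0"
proof -
  obtain P where P: "f = poly P"
    using real_polynomial_function_poly[OF assms(1)] .
  have "P = 0"
    using assms(2) poly_roots_finite[of P] by (auto simp: P)
  then show ?thesis by (simp add: P)
qed

lemma infinite_nonzeros_real_polynomial_function:
  fixes n :: "real \<Rightarrow> real"
  assumes "real_polynomial_function n" and "n t \<noteq> 0"
  shows "infinite {s. n s \<noteq> 0}"
proof
  assume "finite {s. n s \<noteq> 0}"
  moreover have "finite {s. n s = 0}"
    using real_polynomial_function_eq_0_if_infinite[OF assms(1)] assms(2) by blast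
  ultimately have "finite ({s. n s \<noteq> 0} \<union> {s. n s = 0})"
    by simp
  also have "{s. n s \<noteq> 0} \<union> {s. n s = 0} = UNIV"
    by auto
  finally show False
    by (simp add: infinite_UNIV_char_0)
qed

lemma real_polynomial_function_eq_0_generic:
  fixes f n :: "real \<Rightarrow> real"
  assumes f: "real_polynomial_function f" and n: "real_polynomial_function n" "n t \<noteq> 0"
    and gen: "\<And>s. n s \<noteq> 0 \<Longrightarrow> f s = 0"
  shows "f s = 0"
proof (rule real_polynomial_function_eq_0_if_infinite[OF f])
  show "infinite {s. f s = 0}"
    by (rule infinite_super[OF _ infinite_nonzeros_real_polynomial_function[OF n]]) (auto intro: gen)
qed

text \<open>
  Uniqueness for a linear differential equation, in algebraic form: a nonzero solution vanishing at
  \<open>0\<close> would have derivative vanishing there to one order less, while \<open>b * u\<close> vanishes to at least the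
  order of \<open>u\<close>.
\<close>

lemma poly_eq_0_if_singular_free_ode:
  fixes a b u :: "real poly"
  assumes ode: "a * pderiv u = b * u" and a: "poly a 0 \<noteq> 0" and u: "poly u 0 = 0"
  shows "u = 0"
proof (rule ccontr)
  assume "u \<noteq> 0"
  have du: "pderiv u \<noteq> 0"
  proof
    assume "pderiv u = 0"
    then obtain c where "u = [:c:]"
      by (metis pderiv_eq_0_iff degree_eq_zeroE)
    then show False
      using u \<open>u \<noteq> 0\<close> by simp
  qed
  have "a \<noteq> 0" using a by auto
  then have "b \<noteq> 0" using ode du by auto
  have ord: "order 0 u = Suc (order 0 (pderiv u))"
    by (rule order_pderiv[OF \<open>u \<noteq> 0\<close> u])
  have "order 0 a = 0"
    using a by (simp add: order_0I)
  have "order 0 (a * pderiv u) = order 0 (pderiv u)"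
    using \<open>a \<noteq> 0\<close> du \<open>order 0 a = 0\<close> by (simp add: order_mult)
  moreover have "order 0 (b * u) \<ge> order 0 u"
    using \<open>b \<noteq> 0\<close> \<open>u \<noteq> 0\<close> by (simp add: order_mult)
  ultimately show False
    using ode ord by simp
qed

text \<open>
  Since \<open>n 0 \<noteq> 0\<close>, the equation holds at all but finitely many points and hence, between polynomials, everywhere.
\<close>

lemma real_polynomial_function_ode_zero:
  fixes u n b :: "real \<Rightarrow> real"
  assumes polys: "real_polynomial_function u" "real_polynomial_function n"
      "real_polynomial_function b"
    and deriv: "\<And>s. (u has_real_derivative u' s) (at s)"
    and ode: "\<And>s. n s \<noteq> 0 \<Longrightarrow> n s ^ k * u' s = b s * u s"
    and init: "n 0 \<noteq> 0" "u 0 = 0"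
  shows "u s = 0"
proof -
  obtain U M B where U: "u = poly U" and M: "n = poly M" and B: "b = poly B"
    using polys by (metis real_polynomial_function_poly)
  have u': "u' s = poly (pderiv U) s" for s
    by (rule DERIV_unique[OF deriv]) (simp add: U poly_DERIV)
  have "M * (M ^ k * pderiv U - B * U) = 0"
  proof (rule poly_all_0_iff_0[THEN iffD1], rule allI)
    fix s show "poly (M * (M ^ k * pderiv U - B * U)) s = 0"
      using ode[of s] by (cases "n s = 0") (simp_all add: u' U M B)
  qed
  moreover have "M \<noteq> 0"
    using init by (auto simp: M)
  ultimately have "M ^ k * pderiv U = B * U"
    by simp
  then have "U = 0"
    by (rule poly_eq_0_if_singular_free_ode) (use init in \<open>auto simp: M U\<close>)
  then show ?thesis
    by (simp add: U)
qed

section \<open>Flat null hyperplanes of a nilpotent field\<close>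

lemma linear_Basis_expansion:
  fixes L :: "'a::euclidean_space \<Rightarrow> 'b::real_vector"
  assumes "linear L"
  shows "L q = (\<Sum>b\<in>Basis. (q \<bullet> b) *\<^sub>R L b)"
proof -
  have "L q = L (\<Sum>b\<in>Basis. (q \<bullet> b) *\<^sub>R b)"
    by (simp add: euclidean_representation)
  also have "\<dots> = (\<Sum>b\<in>Basis. (q \<bullet> b) *\<^sub>R L b)"
    by (simp add: linear_sum[OF assms] linear_scale[OF assms])
  finally show ?thesis .
qed

lemma polynomial_function_linear_family:
  fixes L :: "'a::euclidean_space \<Rightarrow> 'b::euclidean_space \<Rightarrow> 'c::real_normed_vector"
  assumes lin: "\<And>x. linear (L x)" and L: "\<And>p. polynomial_function (\<lambda>x. L x p)"
    and f: "polynomial_function f"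
  shows "polynomial_function (\<lambda>x. L x (f x))"
proof -
  have "polynomial_function (\<lambda>x. \<Sum>b\<in>Basis. (f x \<bullet> b) *\<^sub>R L x b)"
    by (intro polynomial_function_sum polynomial_function_mult polynomial_function_inner f L
        finite_Basis)
  also have "(\<lambda>x. \<Sum>b\<in>Basis. (f x \<bullet> b) *\<^sub>R L x b) = (\<lambda>x. L x (f x))"
    by (simp flip: linear_Basis_expansion[OF lin])
  finally show ?thesis .
qed

lemma has_derivative_zero_fun:
  fixes f :: "'a::real_normed_vector \<Rightarrow> 'b::real_normed_vector"
  assumes "(f has_derivative f') (at x)" and "\<And>y. f y = 0"
  shows "f' w = 0"
proof -
  have "f = (\<lambda>_. 0)" using assms(2) by auto
  with assms(1) have "(f has_derivative (\<lambda>_. 0)) (at x)" by simp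
  then show ?thesis using has_derivative_unique[OF assms(1)] by simp
qed

text \<open>
  A polynomial field of self-adjoint nilpotent endomorphisms whose derivative is symmetric in the
  direction of differentiation and the argument. Being the field of second derivatives of a
  function enters only through this symmetry.
\<close>

locale nilpotent_field = lorentz_form g e
  for g :: "'a::euclidean_space \<Rightarrow> 'a \<Rightarrow> real" and e :: 'a +
  fixes N :: "'a \<Rightarrow> 'a \<Rightarrow> 'a" and D :: "'a \<Rightarrow> 'a \<Rightarrow> 'a \<Rightarrow> 'a"
  assumes linear_field: "linear (N x)"
    and selfadjoint_field: "g (N x p) q = g p (N x q)"
    and nilpotent_pointwise: "\<exists>k. (N x ^^ k) p = 0"
    and polynomial_field: "polynomial_function (\<lambda>x. N x p)"
    and polynomial_deriv: "polynomial_function (\<lambda>x. D x w p)"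
    and deriv_field: "((\<lambda>x. N x p) has_derivative (\<lambda>w. D x w p)) (at x)"
    and deriv_symmetric: "D x w p = D x p w"

sublocale nilpotent_field \<subseteq> pointwise: selfadjoint_nilpotent g e "N x" for x
  by (intro selfadjoint_nilpotent.intro lorentz_form_axioms selfadjoint_nilpotent_axioms.intro
      linear_field selfadjoint_field nilpotent_pointwise)

context nilpotent_field
begin

lemmas NN_simps = pointwise.N_simps

lemma linear_deriv_direction: "linear (\<lambda>w. D x w p)"
  using has_derivative_linear[OF deriv_field] .

lemma linear_deriv: "linear (D x w)"
  using linear_deriv_direction[of x w] unfolding deriv_symmetric[of x _ w] .

lemmas D_simps = linear_add[OF linear_deriv] linear_diff[OF linear_deriv]
  linear_scale[OF linear_deriv] linear_0[OF linear_deriv]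
  linear_add[OF linear_deriv_direction] linear_diff[OF linear_deriv_direction]
  linear_scale[OF linear_deriv_direction] linear_0[OF linear_deriv_direction]

lemma bounded_bilinear_g: "bounded_bilinear g"
  using bilinear by (simp add: bilinear_conv_bounded_bilinear)

lemmas has_derivative_g = bounded_bilinear.FDERIV[OF bounded_bilinear_g]

lemma deriv_selfadjoint: "g (D x w p) q = g p (D x w q)"
proof -
  have "((\<lambda>x. g (N x p) q) has_derivative (\<lambda>w. g (D x w p) q)) (at x)"
    using has_derivative_g[OF deriv_field has_derivative_const[of q]]
    by (simp add: g_simps)
  moreover have "((\<lambda>x. g (N x p) q) has_derivative (\<lambda>w. g p (D x w q))) (at x)"
    using has_derivative_g[OF has_derivative_const[of p] deriv_field]
    by (simp add: g_simps selfadjoint_field)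
  ultimately show ?thesis
    using has_derivative_unique by metis
qed

text \<open>
  Together with \<open>deriv_symmetric\<close> this makes \<open>g (D x w p) q\<close> invariant under all permutations of \<open>w\<close>, \<open>p\<close>, \<open>q\<close>.
\<close>

lemma deriv_totally_symmetric: "g (D x w p) q = g (D x q p) w"
  by (metis deriv_selfadjoint deriv_symmetric sym)

lemma has_derivative_field_apply:
  assumes "(f has_derivative f') (at x)"
  shows "((\<lambda>x. N x (f x)) has_derivative (\<lambda>w. D x w (f x) + N x (f' w))) (at x)"
proof -
  have "((\<lambda>x. \<Sum>b\<in>Basis. (f x \<bullet> b) *\<^sub>R N x b) has_derivative
      (\<lambda>w. \<Sum>b\<in>Basis. (f x \<bullet> b) *\<^sub>R D x w b + (f' w \<bullet> b) *\<^sub>R N x b)) (at x)"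
    by (intro has_derivative_sum has_derivative_scaleR has_derivative_inner_left assms deriv_field)
  then show ?thesis
    by (simp add: sum.distrib flip: linear_Basis_expansion[OF linear_field]
        linear_Basis_expansion[OF linear_deriv])
qed

lemma polynomial_function_field_apply:
  "polynomial_function f \<Longrightarrow> polynomial_function (\<lambda>x. N x (f x))"
  by (rule polynomial_function_linear_family[OF linear_field polynomial_field])

lemma polynomial_function_deriv_apply:
  "polynomial_function f \<Longrightarrow> polynomial_function (\<lambda>x. D x w (f x))"
  by (rule polynomial_function_linear_family[OF linear_deriv polynomial_deriv])

lemma real_polynomial_function_on_line:
  assumes "polynomial_function f"
  shows "real_polynomial_function (\<lambda>s::real. g (f (x + s *\<^sub>R w)) q)"
proof -
  have "bounded_linear (\<lambda>p. g p q)"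
    by (rule bounded_bilinear.bounded_linear_left[OF bounded_bilinear_g])
  then have 1: "real_polynomial_function ((\<lambda>p. g p q) \<circ> f)"
    using assms by (simp add: polynomial_function_def)
  have "polynomial_function (\<lambda>s::real. x + s *\<^sub>R w)"
    by (intro polynomial_function_add polynomial_function_mult polynomial_function_const
        polynomial_function_id)
  from real_polynomial_function_compose[OF this 1] show ?thesis
    by (simp add: o_def)
qed

text \<open>
  If \<open>g (N x p) q\<close> is the second derivative of a function, this says that the function is affine on the
  hyperplane through \<open>x\<close> orthogonal to \<open>\<xi>\<close>. For null \<open>\<xi>\<close> that hyperplane contains the direction \<open>\<xi>\<close>.
\<close>

definition flat_hyperplane :: "'a \<Rightarrow> 'a \<Rightarrow> bool" where
  "flat_hyperplane \<xi> x \<longleftrightarrow>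
    (\<forall>y p q. g \<xi> (y - x) = 0 \<longrightarrow> g \<xi> p = 0 \<longrightarrow> g \<xi> q = 0 \<longrightarrow> g (N y p) q = 0)"

text \<open>
  The hypothesis \<open>perp\<close> says that \<open>v\<close> changes only by multiples of itself in directions orthogonal to
  it. Along a line \<open>l s = x + s w\<close> with \<open>w\<close> orthogonal to \<open>v x\<close> this hypothesis is available only at \<open>s = 0\<close>
  at first, since \<open>w\<close> might cease to be orthogonal to \<open>v (l s)\<close>. But \<open>u s = g (v (l s)) w\<close> satisfies a
  linear differential equation with \<open>u 0 = 0\<close>, so it vanishes identically; then the same uniqueness
  argument shows that \<open>v (l s)\<close> keeps its direction.
\<close>

lemma flat_hyperplane_through_null_field:
  assumes v': "\<And>x. (v has_derivative v' x) (at x)"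
    and poly_v: "polynomial_function v" and poly_v': "\<And>w. polynomial_function (\<lambda>x. v' x w)"
    and null: "\<And>x. g (v x) (v x) = 0"
    and van: "\<And>x p q. v x \<noteq> 0 \<Longrightarrow> g (v x) p = 0 \<Longrightarrow> g (v x) q = 0 \<Longrightarrow> g (N x p) q = 0"
    and perp: "\<And>x w p. v x \<noteq> 0 \<Longrightarrow> g (v x) w = 0 \<Longrightarrow> g (v x) p = 0 \<Longrightarrow> g (v' x w) p = 0"
    and x: "v x \<noteq> 0"
  shows "flat_hyperplane (v x) x"
  unfolding flat_hyperplane_def
proof (intro allI impI)
  fix y p q
  assume y: "g (v x) (y - x) = 0" and p: "g (v x) p = 0" and q: "g (v x) q = 0"
  have v_eq_0: "v z = 0 \<longleftrightarrow> g (v z) e = 0" for z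
    using null_orthogonal_base_eq_0[OF null, of z] by (auto simp: g_simps)
  define w where "w = y - x"
  define l where "l = (\<lambda>s::real. x + s *\<^sub>R w)"
  define n where "n = (\<lambda>s. g (v (l s)) e)"
  define u where "u = (\<lambda>s. g (v (l s)) w)"
  have lin: "linear (v' z)" for z
    using has_derivative_linear[OF v'] .
  note v'_simps = linear_diff[OF lin] linear_scale[OF lin]
  have poly: "real_polynomial_function (\<lambda>s. g (v (l s)) q)"
       "real_polynomial_function (\<lambda>s. g (v' (l s) r) q)" for q r
    unfolding l_def by (intro real_polynomial_function_on_line poly_v poly_v')+
  have deriv: "((\<lambda>s. g (v (l s)) q) has_real_derivative g (v' (l s) w) q) (at s)" for s q
  proof -
    have "(l has_derivative (\<lambda>h. h *\<^sub>R w)) (at s)"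
      unfolding l_def by (auto intro!: derivative_eq_intros)
    from has_derivative_compose[OF this v']
    have "((\<lambda>s. v (l s)) has_derivative (\<lambda>h. h *\<^sub>R v' (l s) w)) (at s)"
      by (simp add: v'_simps o_def)
    from has_derivative_g[OF this has_derivative_const[of q]]
    show ?thesis
      by (simp add: has_field_derivative_def g_simps mult.commute[of _ "g (v' (l s) w) q"])
  qed
  have n0: "n 0 \<noteq> 0"
    using x v_eq_0 by (simp add: n_def l_def)
  \<comment> \<open>The vectors \<open>w\<close> and \<open>p\<close> are made orthogonal to \<open>v (l s)\<close> by subtracting multiples of \<open>e\<close>,
    and \<open>perp\<close> is applied to the results.\<close>
  have expand: "n s * g (v' (l s) w) p - u s * g (v' (l s) e) p
      = g (v (l s)) p * (g (v' (l s) w) e - u s / n s * g (v' (l s) e) e)"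
    if "n s \<noteq> 0" for s p
  proof -
    define m where "m = n s"
    have m: "m \<noteq> 0" "g (v (l s)) e = m" using that by (simp_all add: m_def n_def)
    have "g (v' (l s) (w - (u s / m) *\<^sub>R e)) (p - (g (v (l s)) p / m) *\<^sub>R e) = 0"
      by (rule perp) (use m v_eq_0[of "l s"] in \<open>auto simp: g_simps u_def\<close>)
    then have "g (v' (l s) w) p - u s / m * g (v' (l s) e) p
      = g (v (l s)) p / m * (g (v' (l s) w) e - u s / m * g (v' (l s) e) e)"
      by (simp add: g_simps v'_simps algebra_simps)
    then have "m * (g (v' (l s) w) p - u s / m * g (v' (l s) e) p)
      = g (v (l s)) p * (g (v' (l s) w) e - u s / m * g (v' (l s) e) e)"
      using m by simp
    then show ?thesis
      using m by (simp add: right_diff_distrib flip: m_def)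
  qed
  have u0: "u s = 0" for s
  proof (rule real_polynomial_function_ode_zero[of u n])
    show "n s ^ 2 * g (v' (l s) w) w = (n s * g (v' (l s) e) w + n s * g (v' (l s) w) e
        - u s * g (v' (l s) e) e) * u s" if "n s \<noteq> 0" for s
    proof -
      have "n s * (n s * g (v' (l s) w) w - u s * g (v' (l s) e) w)
          = n s * (u s * (g (v' (l s) w) e - u s / n s * g (v' (l s) e) e))"
        using expand[OF that, of w] by (simp add: u_def)
      also have "\<dots> = u s * (n s * g (v' (l s) w) e - u s * g (v' (l s) e) e)"
        using that by (simp add: algebra_simps)
      finally show ?thesis
        by (simp add: algebra_simps power2_eq_square)
    qed
    show "real_polynomial_function (\<lambda>s. n s * g (v' (l s) e) w + n s * g (v' (l s) w) e
        - u s * g (v' (l s) e) e)"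
      unfolding n_def u_def
      by (intro real_polynomial_function_diff real_polynomial_function.intros(3,4) poly)
  qed (use n0 y deriv poly in \<open>auto simp: u_def n_def w_def l_def\<close>)
  have parallel: "g (v (l s)) r = 0" if r: "g (v x) r = 0" for s r
  proof (rule real_polynomial_function_ode_zero[where u = "\<lambda>s. g (v (l s)) r" and n = n and k = 1
        and b = "\<lambda>s. g (v' (l s) w) e" and u' = "\<lambda>s. g (v' (l s) w) r"])
    show "n s ^ 1 * g (v' (l s) w) r = g (v' (l s) w) e * g (v (l s)) r"
      if "n s \<noteq> 0" for s
      using expand[OF that, of r] u0 by simp
  qed (use n0 r deriv in \<open>auto simp: n_def l_def intro!: poly[unfolded l_def]\<close>)
  have "g (N (l s) p) q = 0" for s
  proof (rule real_polynomial_function_eq_0_generic[where f = "\<lambda>s. g (N (l s) p) q" and n = n and t = 0])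
    show "real_polynomial_function (\<lambda>s. g (N (l s) p) q)"
      unfolding l_def by (rule real_polynomial_function_on_line[OF polynomial_field])
    show "g (N (l s) p) q = 0" if "n s \<noteq> 0" for s
      by (rule van) (use that p q parallel v_eq_0[of "l s"] in \<open>auto simp: n_def\<close>)
  qed (use n0 poly in \<open>auto simp: n_def\<close>)
  from this[of 1] show "g (N y p) q = 0"
    by (simp add: l_def w_def)
qed

text \<open>
  The vectors \<open>p\<close> and \<open>q\<close> are extended to vector fields \<open>proj p\<close>, \<open>proj q\<close> orthogonal to \<open>v\<close>. Then
  \<open>g (N y (proj p y)) (proj q y)\<close> is identically zero, and the claim is its derivative at \<open>x\<close> divided
  by \<open>g (v x) e\<close>.
\<close>

lemma deriv_vanish_on_perp:
  assumes v': "(v has_derivative v') (at x)"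
    and van: "\<And>x p q. v x \<noteq> 0 \<Longrightarrow> g (v x) p = 0 \<Longrightarrow> g (v x) q = 0 \<Longrightarrow> g (N x p) q = 0"
    and x: "g (v x) e \<noteq> 0" and p: "g (v x) p = 0" and q: "g (v x) q = 0"
  shows "g (v x) e * g (D x w p) q = g (v' w) p * g (N x e) q + g (v' w) q * g (N x e) p"
proof -
  define proj where "proj = (\<lambda>p y. g (v y) e *\<^sub>R p - g (v y) p *\<^sub>R e)"
  define proj' where "proj' = (\<lambda>p w. g (v' w) e *\<^sub>R p - g (v' w) p *\<^sub>R e)"
  have vx: "v x \<noteq> 0"
    using x by (auto simp: g_simps)
  have proj_perp: "g (v y) (proj p y) = 0" for y p
    by (simp add: proj_def g_simps)
  have zero: "g (N y (proj p y)) (proj q y) = 0" for y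
  proof (cases "v y = 0")
    case True
    then show ?thesis by (simp add: proj_def g_simps NN_simps)
  next
    case False
    then show ?thesis by (rule van) (rule proj_perp)+
  qed
  have dg: "((\<lambda>y. g (v y) r) has_derivative (\<lambda>w. g (v' w) r)) (at x)" for r
    using has_derivative_g[OF v' has_derivative_const[of r]] by (simp add: g_simps)
  have proj': "(proj r has_derivative proj' r) (at x)" for r
    unfolding proj_def proj'_def
    by (intro has_derivative_diff has_derivative_scaleR_left dg)
  have "g (N x (proj p x)) (proj' q w)
      + g (D x w (proj p x) + N x (proj' p w)) (proj q x) = 0"
    by (rule has_derivative_zero_fun[OF has_derivative_g[OF
          has_derivative_field_apply[OF proj'] proj'] zero])
  moreover have "proj r x = g (v x) e *\<^sub>R r" if "g (v x) r = 0" for r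
    using that by (simp add: proj_def)
  ultimately have "g (v x) e * (g (v x) e * g (D x w p) q
      - g (v' w) p * g (N x e) q - g (v' w) q * g (N x p) e) = 0"
    using p q van[OF vx p q]
    by (simp add: proj'_def g_simps NN_simps D_simps algebra_simps)
  moreover have "g (N x p) e = g (N x e) p"
    by (metis selfadjoint_field sym)
  ultimately show ?thesis
    using x by auto
qed

text \<open>
  Write \<open>v = N\<^sup>2 e\<close> and \<open>a = N e\<close>, so that \<open>g a a = g v e \<noteq> 0\<close>, and \<open>\<tau> w p = g (v' w) p\<close> on the complement of \<open>v\<close>;
  the claim is \<open>\<tau> = 0\<close>. Differentiating \<open>N v = 0\<close> and using total symmetry gives \<open>\<tau> w a = 0\<close>. Up to the
  factor \<open>g v e\<close>, the third derivative in the directions \<open>w\<close>, \<open>p\<close>, \<open>q\<close> is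
  \<open>\<tau> w p * g a q + \<tau> w q * g a p\<close>, and this expression has to be symmetric: comparing its values at
  permutations of \<open>(w, p, a)\<close> yields first \<open>\<tau> a w = 0\<close> and then \<open>\<tau> w p = 0\<close>.
\<close>

lemma null_field_square:
  assumes ne: "N x (N x e) \<noteq> 0"
  shows "flat_hyperplane (N x (N x e)) x"
proof (rule flat_hyperplane_through_null_field[where v = "\<lambda>x. N x (N x e)"
      and v' = "\<lambda>x w. D x w (N x e) + N x (D x w e)"])
  show v': "((\<lambda>x. N x (N x e)) has_derivative (\<lambda>w. D x w (N x e) + N x (D x w e))) (at x)" for x
    by (rule has_derivative_field_apply[OF deriv_field])
  show "polynomial_function (\<lambda>x. N x (N x e))"
    by (intro polynomial_function_field_apply polynomial_field)
  show "polynomial_function (\<lambda>x. D x w (N x e) + N x (D x w e))" for w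
    by (intro polynomial_function_add polynomial_function_field_apply
        polynomial_function_deriv_apply polynomial_field polynomial_deriv)
  show null: "g (N x (N x e)) (N x (N x e)) = 0" for x
    by (simp add: selfadjoint_field pointwise.cube_eq_0 g_simps NN_simps)
  show van: "g (N x p) q = 0"
    if "N x (N x e) \<noteq> 0" "g (N x (N x e)) p = 0" "g (N x (N x e)) q = 0" for x p q
    using that by (rule pointwise.vanish_on_perp_square)
  show "N x (N x e) \<noteq> 0" by fact
  show "g (D x w (N x e) + N x (D x w e)) p = 0"
    if ne: "N x (N x e) \<noteq> 0" and w: "g (N x (N x e)) w = 0" and p: "g (N x (N x e)) p = 0"
    for x w p
  proof -
    define v a n where "v = N x (N x e)" and "a = N x e" and "n = g v e"
    define v' where "v' = (\<lambda>w. D x w (N x e) + N x (D x w e))"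
    have n: "n \<noteq> 0"
      using null_orthogonal_base_eq_0[OF null] ne by (auto simp: n_def v_def)
    have va: "g v a = 0"
      by (simp add: v_def a_def selfadjoint_field pointwise.cube_eq_0 g_simps)
    have aa: "g a a = n"
      by (simp add: n_def v_def a_def selfadjoint_field)
    have key: "n * g (D x w p) q = g (v' w) p * g a q + g (v' w) q * g a p"
      if "g v p = 0" "g v q = 0" for w p q
      unfolding n_def v_def a_def v'_def
      by (rule deriv_vanish_on_perp[where v = "\<lambda>x. N x (N x e)"
            and v' = "\<lambda>w. D x w (N x e) + N x (D x w e)"])
        (use v' van that n in \<open>simp_all add: n_def v_def\<close>)
    have v_v': "g v (v' w) = 0" for w
      using has_derivative_zero_fun[OF has_derivative_g[OF v' v'] null, of x w]
      by (simp add: v_def v'_def sym[of _ "N x (N x e)"])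
    have kernel: "D x w v + N x (v' w) = 0" for w
      using has_derivative_zero_fun[OF has_derivative_field_apply[OF v'] pointwise.cube_eq_0, of x w]
      by (simp add: v_def v'_def)
    have a_v': "g (v' w) a = 0" if w: "g v w = 0" for w
    proof -
      have "g (v' w) a = g (N x (v' w)) e"
        by (simp add: a_def selfadjoint_field)
      also have "\<dots> = - g (D x w v) e"
        using kernel[of w] by (simp add: g_simps eq_neg_iff_add_eq_0 add.commute flip: g_simps(1))
      also have "g (D x w v) e = g (D x e v) w"
        by (metis deriv_totally_symmetric deriv_symmetric)
      also have "\<dots> = - g (N x (v' e)) w"
        using kernel[of e] by (simp add: g_simps eq_neg_iff_add_eq_0 flip: g_simps(1))
      also have "g (N x (v' e)) w = 0"
        using van ne v_v' w unfolding v_def by blast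
      finally show ?thesis by simp
    qed
    have v'_a: "g (v' a) w = 0" if w: "g v w = 0" for w
    proof -
      have "n * g (D x a w) a = g (v' a) w * n"
        using key[OF w va, of a] a_v'[OF va] by (simp add: aa)
      moreover have "n * g (D x w a) a = 0"
        using key[OF va va, of w] a_v'[OF w] by simp
      ultimately show ?thesis
        using n by (simp add: deriv_symmetric[of x a w])
    qed
    have w': "g v w = 0" and p': "g v p = 0"
      using w p by (simp_all add: v_def)
    have "n * g (D x w p) a = g (v' w) p * n"
      using key[OF p' va, of w] a_v'[OF w'] by (simp add: aa)
    moreover have "n * g (D x a p) w = 0"
      using key[OF p' w', of a] v'_a[OF w'] v'_a[OF p'] by simp
    ultimately have "g (v' w) p = 0"
      using n deriv_totally_symmetric[of x w p a] by simp
    then show ?thesis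
      by (simp add: v'_def)
  qed
qed

text \<open>
  Here \<open>v = N e\<close>, so \<open>g (v' w) p\<close> is the third derivative in the directions \<open>w\<close>, \<open>e\<close>, \<open>p\<close>. By symmetry it
  is the derivative in direction \<open>e\<close> of the form on the complement of \<open>v\<close>, which is zero.
\<close>

lemma null_field_linear:
  assumes sq: "\<And>x p. N x (N x p) = 0" and ne: "N x e \<noteq> 0"
  shows "flat_hyperplane (N x e) x"
proof (rule flat_hyperplane_through_null_field[where v = "\<lambda>x. N x e" and v' = "\<lambda>x w. D x w e"])
  show null: "g (N x e) (N x e) = 0" for x
    by (simp add: selfadjoint_field sq g_simps)
  show van: "g (N x p) q = 0"
    if "N x e \<noteq> 0" "g (N x e) p = 0" "g (N x e) q = 0" for x p q
    using sq that(1,3) by (rule pointwise.vanish_on_perp_linear)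
  show "g (D x w e) p = 0"
    if ne: "N x e \<noteq> 0" and w: "g (N x e) w = 0" and p: "g (N x e) p = 0" for x w p
  proof -
    have n: "g (N x e) e \<noteq> 0"
      using null_orthogonal_base_eq_0[OF null] ne by auto
    have "g (N x e) e * g (D x e w) p
        = g (D x e e) w * g (N x e) p + g (D x e e) p * g (N x e) w"
      by (rule deriv_vanish_on_perp[where v = "\<lambda>x. N x e" and v' = "\<lambda>w. D x w e"])
        (use deriv_field van n w p in simp_all)
    then show ?thesis
      using n w p by (simp add: deriv_symmetric[of x w e])
  qed
qed (use ne in \<open>auto intro: deriv_field polynomial_field polynomial_deriv\<close>)

lemma null_field_exists:
  assumes "N x0 p0 \<noteq> 0"
  obtains v x1 where "polynomial_function v" "v x1 \<noteq> 0"
    "\<And>x. g (v x) (v x) = 0" "\<And>x. (\<And>p. N x p = 0) \<Longrightarrow> v x = 0"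
    "\<And>x. v x \<noteq> 0 \<Longrightarrow> flat_hyperplane (v x) x"
proof (cases "\<forall>x. N x (N x e) = 0")
  case True
  have sq: "N x (N x p) = 0" for x p
    using pointwise.square_eq_0_of_base True by blast
  show ?thesis
  proof (rule that[of "\<lambda>x. N x e" x0])
    show "N x0 e \<noteq> 0"
      using pointwise.eq_0_of_base[OF sq] assms by blast
  qed (auto simp: selfadjoint_field sq g_simps intro: polynomial_field null_field_linear[OF sq])
next
  case False
  then obtain x1 where "N x1 (N x1 e) \<noteq> 0" by blast
  then show ?thesis
    by (intro that[of "\<lambda>x. N x (N x e)" x1])
      (auto simp: selfadjoint_field pointwise.cube_eq_0 g_simps NN_simps
        intro: polynomial_field polynomial_function_field_apply null_field_square)
qed

text \<open>
  Countably many hyperplanes have measure zero and so do not cover the space.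
\<close>

lemma generic_vector:
  assumes "countable A" and "\<And>a. a \<in> A \<Longrightarrow> a \<noteq> 0"
  shows "\<exists>w. \<forall>a\<in>A. g a w \<noteq> 0"
proof -
  have neg: "negligible {w. g a w = 0}" if "a \<in> A" for a
  proof -
    define b where "b = (\<Sum>i\<in>Basis. g a i *\<^sub>R i)"
    have lin: "linear (g a)"
      using bilinear by (simp add: bilinear_def)
    have g_b: "g a w = b \<bullet> w" for w
      by (subst linear_Basis_expansion[OF lin])
        (simp add: b_def inner_sum_left inner_commute[of w] mult.commute)
    have "b \<noteq> 0"
      using nondegenerate[of a] assms(2)[OF that] by (auto simp: g_b)
    then show ?thesis
      using negligible_hyperplane[of b 0] by (simp add: g_b)
  qed
  have "negligible (\<Union>a\<in>A. {w. g a w = 0})"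
    using assms(1) neg by (intro negligible_countable_Union) auto
  then have "(\<Union>a\<in>A. {w. g a w = 0}) \<noteq> UNIV"
    using non_negligible_UNIV by metis
  then show ?thesis by auto
qed

lemma flat_hyperplane_scaleR: "c \<noteq> 0 \<Longrightarrow> flat_hyperplane (c *\<^sub>R \<xi>) x \<longleftrightarrow> flat_hyperplane \<xi> x"
  by (simp add: flat_hyperplane_def bilinear_lmul[OF bilinear])

lemma vanish_if_two_flat_hyperplanes:
  assumes "g \<xi> \<xi> = 0" "g \<xi> e = 1" "flat_hyperplane \<xi> x" "g \<xi> (y - x) = 0"
    and "g \<eta> \<eta> = 0" "g \<eta> e = 1" "flat_hyperplane \<eta> z" "g \<eta> (y - z) = 0"
    and "\<xi> \<noteq> \<eta>"
  shows "N y q = 0"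
  by (rule pointwise.eq_0_of_two_nulls[of \<xi> \<eta>])
    (use assms in \<open>auto simp: flat_hyperplane_def\<close>)

text \<open>
  Three pairwise distinct normalized null vectors are linearly independent, because a null vector in
  the plane spanned by two null vectors is a multiple of one of them.
\<close>

lemma distinct_nulls_independent:
  assumes "g \<xi> \<xi> = 0" "g \<xi> e = 1" "g \<eta> \<eta> = 0" "g \<eta> e = 1" "g \<zeta> \<zeta> = 0" "g \<zeta> e = 1"
    and ne: "\<xi> \<noteq> \<zeta>" "\<eta> \<noteq> \<zeta>" "\<xi> \<noteq> \<eta>" and st: "s \<noteq> 0" "t \<noteq> 0"
  shows "s *\<^sub>R (\<eta> - \<zeta>) \<noteq> t *\<^sub>R (\<xi> - \<zeta>)"
proof
  assume eq: "s *\<^sub>R (\<eta> - \<zeta>) = t *\<^sub>R (\<xi> - \<zeta>)"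
  have nz: "g \<alpha> \<beta> \<noteq> 0" if "g \<alpha> \<alpha> = 0" "g \<alpha> e = 1" "g \<beta> \<beta> = 0" "g \<beta> e = 1" "\<alpha> \<noteq> \<beta>" for \<alpha> \<beta>
  proof -
    have "\<beta> \<noteq> 0"
      using that by (auto simp: g_simps)
    then show ?thesis
      using orthogonal_nulls_parallel[of \<alpha> \<beta>] that by auto
  qed
  have eta: "s *\<^sub>R \<eta> = t *\<^sub>R \<xi> + (s - t) *\<^sub>R \<zeta>"
    using eq by (simp add: algebra_simps)
  have "0 = g (s *\<^sub>R \<eta>) (s *\<^sub>R \<eta>)"
    using assms by (simp add: g_simps)
  also have "\<dots> = 2 * t * (s - t) * g \<xi> \<zeta>"
    unfolding eta using assms sym[of \<zeta> \<xi>] by (simp add: g_simps)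
  finally have "s = t"
    using nz[of \<xi> \<zeta>] assms by simp
  with eq st ne show False by simp
qed

text \<open>
  On the line \<open>x0 + t e\<close>, which is transversal to all null hyperplanes, almost every point carries a
  flat null hyperplane with normalized direction \<open>\<nu> t\<close>.
  
  Suppose \<open>\<nu>\<close> takes infinitely many values. Each of the hyperplanes at \<open>t \<noteq> 0\<close> with \<open>\<nu> t \<noteq> \<nu> 0\<close> cuts the
  hyperplane at \<open>t = 0\<close> in a subset on which \<open>N\<close> vanishes, by \<open>vanish_if_two_flat_hyperplanes\<close>, and
  \<open>distinct_nulls_independent\<close> ensures that these subsets are different. A generic line through \<open>x0\<close>
  inside the hyperplane meets infinitely many of them in distinct points, so the polynomial \<open>N\<close>
  vanishes on the whole line, in particular at \<open>x0\<close>, where it was chosen nonzero.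
  
  So some \<open>\<xi>\<close> is the direction at infinitely many \<open>t\<close>. Every line parallel to \<open>e\<close> crosses the
  corresponding infinitely many parallel flat hyperplanes, so the polynomial \<open>g (N x \<xi>) \<xi>\<close> vanishes
  along it.
\<close>

theorem null_direction_exists:
  assumes "e \<noteq> 0"
  shows "\<exists>\<xi>. \<xi> \<noteq> 0 \<and> (\<forall>x. g (N x \<xi>) \<xi> = 0)"
proof (cases "\<forall>x p. N x p = 0")
  case True
  then show ?thesis
    using assms by (auto simp: g_simps)
next
  case False
  then obtain v x0 where poly_v: "polynomial_function v" and x0: "v x0 \<noteq> 0"
    and null: "\<And>x. g (v x) (v x) = 0" and v_zero: "\<And>x. (\<And>p. N x p = 0) \<Longrightarrow> v x = 0"
    and flat: "\<And>x. v x \<noteq> 0 \<Longrightarrow> flat_hyperplane (v x) x"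
    using null_field_exists by metis
  have v_eq_0: "v z = 0 \<longleftrightarrow> g (v z) e = 0" for z
    using null_orthogonal_base_eq_0[OF null, of z] by (auto simp: g_simps)
  define \<nu> where "\<nu> = (\<lambda>t::real. v (x0 + t *\<^sub>R e) /\<^sub>R g (v (x0 + t *\<^sub>R e)) e)"
  define J where "J = {t. g (v (x0 + t *\<^sub>R e)) e \<noteq> 0}"
  have J: "infinite J"
    unfolding J_def
    by (rule infinite_nonzeros_real_polynomial_function[where t = 0])
      (use real_polynomial_function_on_line[OF poly_v] x0 v_eq_0 in auto)
  have "0 \<in> J"
    using x0 v_eq_0 by (auto simp: J_def)
  have \<nu>: "g (\<nu> t) (\<nu> t) = 0" "g (\<nu> t) e = 1" "flat_hyperplane (\<nu> t) (x0 + t *\<^sub>R e)" if "t \<in> J" for t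
    using that null flat[of "x0 + t *\<^sub>R e"] v_eq_0[of "x0 + t *\<^sub>R e"]
    by (simp_all add: \<nu>_def J_def bilinear_lmul[OF bilinear] bilinear_rmul[OF bilinear]
        flat_hyperplane_scaleR)
  have "finite (\<nu> ` J)"
  proof (rule ccontr)
    assume "infinite (\<nu> ` J)"
    then have "infinite (\<nu> ` J - {\<nu> 0})"
      by simp
    then obtain f :: "nat \<Rightarrow> 'a" where "inj f" and f: "range f \<subseteq> \<nu> ` J - {\<nu> 0}"
      using infinite_countable_subset by blast
    have "\<exists>t. t \<in> J \<and> f i = \<nu> t \<and> \<nu> t \<noteq> \<nu> 0" for i
      using subsetD[OF f rangeI[of f i]] by auto
    then obtain \<tau> where \<tau>: "\<And>i. \<tau> i \<in> J" "\<And>i. f i = \<nu> (\<tau> i)" "\<And>i. \<nu> (\<tau> i) \<noteq> \<nu> 0"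
      by metis
    have \<tau>0: "\<tau> i \<noteq> 0" for i
      using \<tau>(3)[of i] by auto
    have distinct: "\<nu> (\<tau> i) \<noteq> \<nu> (\<tau> j)" if "i \<noteq> j" for i j
      using \<open>inj f\<close> that by (metis \<tau>(2) injD)
    \<comment> \<open>The line will be \<open>x0 + s w\<close>, where \<open>w\<close> is the component of \<open>w'\<close> orthogonal to \<open>\<nu> 0\<close>; then
      \<open>g (\<nu> t) w = g (\<nu> t - \<nu> 0) w'\<close>. It meets the hyperplane at \<open>\<tau> i\<close> for \<open>s = \<tau> i / g (\<delta> i) w'\<close>.\<close>
    define \<delta> where "\<delta> = (\<lambda>i. \<nu> (\<tau> i) - \<nu> 0)"
    obtain w' where w': "\<And>i. g (\<delta> i) w' \<noteq> 0"
      "\<And>i j. i \<noteq> j \<Longrightarrow> g (\<tau> i *\<^sub>R \<delta> j - \<tau> j *\<^sub>R \<delta> i) w' \<noteq> 0"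
    proof -
      have "\<exists>w'. \<forall>a\<in>range \<delta> \<union> (\<lambda>(i, j). \<tau> i *\<^sub>R \<delta> j - \<tau> j *\<^sub>R \<delta> i) ` {(i, j). i \<noteq> j}. g a w' \<noteq> 0"
      proof (rule generic_vector)
        fix a assume "a \<in> range \<delta> \<union> (\<lambda>(i, j). \<tau> i *\<^sub>R \<delta> j - \<tau> j *\<^sub>R \<delta> i) ` {(i, j). i \<noteq> j}"
        then consider i where "a = \<delta> i"
          | i j where "i \<noteq> j" "a = \<tau> i *\<^sub>R \<delta> j - \<tau> j *\<^sub>R \<delta> i"
          by (elim UnE imageE) auto
        then show "a \<noteq> 0"
        proof cases
          case 1
          then show ?thesis
            using \<tau>(3)[of i] by (simp add: \<delta>_def)
        next
          case 2
          have "\<tau> i *\<^sub>R \<delta> j \<noteq> \<tau> j *\<^sub>R \<delta> i"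
            unfolding \<delta>_def
            by (rule distinct_nulls_independent) (intro \<nu> \<tau> \<tau>0 \<open>0 \<in> J\<close> distinct[OF \<open>i \<noteq> j\<close>])+
          with 2 show ?thesis by simp
        qed
      qed simp
      then obtain w' where generic: "\<forall>a\<in>range \<delta> \<union>
          (\<lambda>(i, j). \<tau> i *\<^sub>R \<delta> j - \<tau> j *\<^sub>R \<delta> i) ` {(i, j). i \<noteq> j}. g a w' \<noteq> 0" ..
      show ?thesis
      proof (rule that)
        show "g (\<delta> i) w' \<noteq> 0" for i
          using bspec[OF generic UnI1[OF rangeI[of \<delta> i]]] .
        show "g (\<tau> i *\<^sub>R \<delta> j - \<tau> j *\<^sub>R \<delta> i) w' \<noteq> 0" if "i \<noteq> j" for i j
          by (rule bspec[OF generic]) (rule UnI2, rule image_eqI[of _ _ "(i, j)"], use that in simp_all)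
      qed
    qed
    define w where "w = w' - g (\<nu> 0) w' *\<^sub>R e"
    have w: "g (\<nu> 0) w = 0"
      using \<nu>[OF \<open>0 \<in> J\<close>] by (simp add: w_def g_simps)
    have \<delta>w: "g (\<nu> (\<tau> i)) w = g (\<delta> i) w'" for i
      using \<nu>[OF \<tau>(1)] by (simp add: w_def g_simps \<delta>_def)
    define s where "s = (\<lambda>i. \<tau> i / g (\<delta> i) w')"
    have "inj s"
    proof (rule injI, rule ccontr)
      fix i j assume "s i = s j" "i \<noteq> j"
      then have "\<tau> i * g (\<delta> j) w' = \<tau> j * g (\<delta> i) w'"
        using w'(1) by (simp add: s_def field_simps)
      then show False
        using w'(2)[OF \<open>i \<noteq> j\<close>] by (simp add: g_simps)
    qed
    have "N (x0 + s i *\<^sub>R w) p = 0" for i p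
    proof (rule vanish_if_two_flat_hyperplanes[of "\<nu> 0" "x0 + 0 *\<^sub>R e" _ "\<nu> (\<tau> i)" "x0 + \<tau> i *\<^sub>R e"])
      show "g (\<nu> 0) ((x0 + s i *\<^sub>R w) - (x0 + 0 *\<^sub>R e)) = 0"
        by (simp add: g_simps w)
      show "g (\<nu> (\<tau> i)) ((x0 + s i *\<^sub>R w) - (x0 + \<tau> i *\<^sub>R e)) = 0"
        using w'(1)[of i] \<nu>[OF \<tau>(1)] by (simp add: g_simps \<delta>w s_def)
      show "\<nu> 0 \<noteq> \<nu> (\<tau> i)"
        using \<tau>(3)[of i] by simp
    qed (intro \<nu> \<tau> \<open>0 \<in> J\<close>)+
    then have zeros: "range s \<subseteq> {t. g (N (x0 + t *\<^sub>R w) p) q = 0}" for p q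
      by (auto simp: g_simps)
    have "g (N (x0 + t *\<^sub>R w) p) q = 0" for t p q
    proof (rule real_polynomial_function_eq_0_if_infinite[where f = "\<lambda>t. g (N (x0 + t *\<^sub>R w) p) q"])
      show "real_polynomial_function (\<lambda>t. g (N (x0 + t *\<^sub>R w) p) q)"
        by (rule real_polynomial_function_on_line[OF polynomial_field])
      show "infinite {t. g (N (x0 + t *\<^sub>R w) p) q = 0}"
        by (rule infinite_super[OF zeros]) (simp add: range_inj_infinite \<open>inj s\<close>)
    qed
    from this[of 0] have "N x0 p = 0" for p
      by (intro nondegenerate) simp
    then show False
      using v_zero x0 by blast
  qed
  then obtain t0 where t0: "t0 \<in> J" and inf: "infinite {t \<in> J. \<nu> t = \<nu> t0}"
    using pigeonhole_infinite[OF J] by blast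
  define \<xi> where "\<xi> = \<nu> t0"
  have \<xi>: "g \<xi> \<xi> = 0" "g \<xi> e = 1"
    using \<nu>[OF t0] by (auto simp: \<xi>_def)
  have "g (N x \<xi>) \<xi> = 0" for x
  proof -
    \<comment> \<open>The line through \<open>x\<close> meets the hyperplane at \<open>t\<close> for \<open>r = t - c\<close>.\<close>
    define c where "c = g \<xi> (x - x0)"
    have "g (N (x + r *\<^sub>R e) \<xi>) \<xi> = 0" for r
    proof (rule real_polynomial_function_eq_0_if_infinite[where f = "\<lambda>r. g (N (x + r *\<^sub>R e) \<xi>) \<xi>"])
      show "real_polynomial_function (\<lambda>r. g (N (x + r *\<^sub>R e) \<xi>) \<xi>)"
        by (rule real_polynomial_function_on_line[OF polynomial_field])
      have "(\<lambda>t. t - c) ` {t \<in> J. \<nu> t = \<nu> t0} \<subseteq> {r. g (N (x + r *\<^sub>R e) \<xi>) \<xi> = 0}"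
      proof clarify
        fix t assume t: "t \<in> J" "\<nu> t = \<nu> t0"
        have "g \<xi> ((x + (t - c) *\<^sub>R e) - (x0 + t *\<^sub>R e)) = 0"
          using \<xi> by (simp add: c_def g_simps)
        then show "g (N (x + (t - c) *\<^sub>R e) \<xi>) \<xi> = 0"
          using \<nu>(3)[OF t(1)] t(2) \<xi> unfolding flat_hyperplane_def \<xi>_def by metis
      qed
      moreover have "infinite ((\<lambda>t. t - c) ` {t \<in> J. \<nu> t = \<nu> t0})"
        using inf by (subst finite_image_iff) (auto simp: inj_on_def)
      ultimately show "infinite {r. g (N (x + r *\<^sub>R e) \<xi>) \<xi> = 0}"
        by (rule infinite_super)
    qed
    from this[of 0] show ?thesis by simp
  qed
  moreover have "\<xi> \<noteq> 0"
    using \<xi> by (auto simp: g_simps)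
  ultimately show ?thesis by blast
qed

end

section \<open>Polynomials in several variables and their Hessians\<close>

definition monomial_at :: "('n::finite \<Rightarrow>\<^sub>0 nat) \<Rightarrow> real ^ 'n \<Rightarrow> real" where
  "monomial_at m x = (\<Prod>i\<in>UNIV. (x $ i) ^ Poly_Mapping.lookup m i)"

lemma eval_rpoly_superset:
  assumes "finite K" "Poly_Mapping.keys p \<subseteq> K"
  shows "eval_rpoly p x = (\<Sum>m\<in>K. Poly_Mapping.lookup p m * monomial_at m x)"
  unfolding eval_rpoly_def monomial_at_def
  by (rule sum.mono_neutral_left) (use assms in \<open>auto simp: in_keys_iff\<close>)

lemma eval_rpoly_0 [simp]: "eval_rpoly 0 x = 0"
  by (simp add: eval_rpoly_def)

lemma eval_rpoly_add: "eval_rpoly (p + q) x = eval_rpoly p x + eval_rpoly q x"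
proof -
  let ?K = "Poly_Mapping.keys p \<union> Poly_Mapping.keys q"
  have "Poly_Mapping.keys (p + q) \<subseteq> ?K"
    by (rule keys_add)
  then show ?thesis
    by (simp add: eval_rpoly_superset[of ?K] lookup_add distrib_right sum.distrib)
qed

lemma eval_rpoly_sum: "eval_rpoly (\<Sum>a\<in>A. f a) x = (\<Sum>a\<in>A. eval_rpoly (f a) x)"
  by (induction A rule: infinite_finite_induct) (simp_all add: eval_rpoly_add)

lemma eval_rpoly_single: "eval_rpoly (Poly_Mapping.single m c) x = c * monomial_at m x"
  by (simp add: eval_rpoly_superset[of "{m}"])

lemma rpoly_eq_sum_single:
  "p = (\<Sum>m\<in>Poly_Mapping.keys p. Poly_Mapping.single m (Poly_Mapping.lookup p m))"
  by (rule poly_mapping_eqI)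
    (simp add: lookup_sum lookup_single when_def in_keys_iff)

lemma monomial_at_add: "monomial_at (m + m') x = monomial_at m x * monomial_at m' x"
  by (simp add: monomial_at_def lookup_add power_add prod.distrib)

lemma eval_rpoly_mult: "eval_rpoly (p * q) x = eval_rpoly p x * eval_rpoly q x"
proof -
  let ?s = "\<lambda>p m. Poly_Mapping.single m (Poly_Mapping.lookup p m)"
  have "p * q = (\<Sum>m\<in>Poly_Mapping.keys p. \<Sum>m'\<in>Poly_Mapping.keys q. ?s p m * ?s q m')"
    by (simp only: sum_product[symmetric] rpoly_eq_sum_single[symmetric])
  then have "eval_rpoly (p * q) x = (\<Sum>m\<in>Poly_Mapping.keys p. \<Sum>m'\<in>Poly_Mapping.keys q.
      eval_rpoly (?s p m) x * eval_rpoly (?s q m') x)"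
    by (simp add: eval_rpoly_sum mult_single eval_rpoly_single monomial_at_add mult_ac)
  also have "\<dots> = eval_rpoly p x * eval_rpoly q x"
    by (simp only: eval_rpoly_sum[symmetric] sum_product[symmetric] rpoly_eq_sum_single[symmetric])
  finally show ?thesis .
qed

lemma eval_rpoly_1: "eval_rpoly 1 x = 1"
  by (simp add: eval_rpoly_single monomial_at_def flip: single_one)

lemma partial_deriv_superset:
  assumes "finite K" "Poly_Mapping.keys p \<subseteq> K"
  shows "partial_deriv i p = (\<Sum>m\<in>K. Poly_Mapping.single (m - Poly_Mapping.single i 1)
    (real (Poly_Mapping.lookup m i) * Poly_Mapping.lookup p m))"
  unfolding partial_deriv_def
  by (rule sum.mono_neutral_left) (use assms in \<open>auto simp: in_keys_iff\<close>)

lemma partial_deriv_single: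
  "partial_deriv i (Poly_Mapping.single m c)
    = Poly_Mapping.single (m - Poly_Mapping.single i 1) (real (Poly_Mapping.lookup m i) * c)"
  by (simp add: partial_deriv_superset[of "{m}"])

lemma partial_deriv_add: "partial_deriv i (p + q) = partial_deriv i p + partial_deriv i q"
proof -
  let ?K = "Poly_Mapping.keys p \<union> Poly_Mapping.keys q"
  have "Poly_Mapping.keys (p + q) \<subseteq> ?K"
    by (rule keys_add)
  then show ?thesis
    by (simp add: partial_deriv_superset[of ?K] lookup_add distrib_left single_add sum.distrib)
qed

lemma partial_deriv_sum: "partial_deriv i (\<Sum>a\<in>A. f a) = (\<Sum>a\<in>A. partial_deriv i (f a))"
proof -
  have "partial_deriv i 0 = 0"
    by (simp add: partial_deriv_def)
  then show ?thesis
    by (induction A rule: infinite_finite_induct) (simp_all add: partial_deriv_add)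
qed

lemma partial_deriv_commute: "partial_deriv i (partial_deriv j p) = partial_deriv j (partial_deriv i p)"
proof (cases "i = j")
  case False
  have "partial_deriv i (partial_deriv j (Poly_Mapping.single m c))
      = partial_deriv j (partial_deriv i (Poly_Mapping.single m c))" for m and c :: real
    using False
    by (simp add: partial_deriv_single lookup_minus lookup_single diff_diff_add add.commute mult_ac)
  then show ?thesis
    by (subst (1 2) rpoly_eq_sum_single) (simp add: partial_deriv_sum)
qed simp

lemma has_derivative_monomial_at:
  "(monomial_at m has_derivative (\<lambda>w. \<Sum>i\<in>UNIV. w $ i *
     (real (Poly_Mapping.lookup m i) * monomial_at (m - Poly_Mapping.single i 1) x))) (at x)"
proof -
  have factor: "((\<lambda>x. x $ i ^ l) has_derivative (\<lambda>w. w $ i * (real l * x $ i ^ (l - 1)))) (at x)"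
    for i and l :: nat and x :: "real ^ 'n"
  proof -
    have "((\<lambda>x. x $ i) has_derivative (\<lambda>w. w $ i)) (at x)"
      by (rule bounded_linear_imp_has_derivative[OF bounded_linear_vec_nth])
    from has_derivative_power[OF this, of l] show ?thesis
      by (simp add: mult_ac)
  qed
  have "monomial_at (m - Poly_Mapping.single i 1) x
      = x $ i ^ (Poly_Mapping.lookup m i - 1) * (\<Prod>j\<in>UNIV - {i}. x $ j ^ Poly_Mapping.lookup m j)" for i
    unfolding monomial_at_def
    by (subst prod.remove[of _ i]) (auto simp: lookup_minus lookup_single intro!: prod.cong)
  note shift = this
  have "((\<lambda>x. \<Prod>i\<in>UNIV. x $ i ^ Poly_Mapping.lookup m i) has_derivative
      (\<lambda>w. \<Sum>i\<in>UNIV. w $ i * (real (Poly_Mapping.lookup m i) * x $ i ^ (Poly_Mapping.lookup m i - 1)) *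
        (\<Prod>j\<in>UNIV - {i}. x $ j ^ Poly_Mapping.lookup m j))) (at x)"
    by (rule has_derivative_prod) (rule factor)
  then show ?thesis
    unfolding shift by (simp add: monomial_at_def[abs_def] mult_ac)
qed

lemma has_derivative_eval_rpoly:
  "(eval_rpoly p has_derivative (\<lambda>w. \<Sum>i\<in>UNIV. w $ i * eval_rpoly (partial_deriv i p) x)) (at x)"
proof -
  have "((\<lambda>x. \<Sum>m\<in>Poly_Mapping.keys p. Poly_Mapping.lookup p m * monomial_at m x) has_derivative
      (\<lambda>w. \<Sum>m\<in>Poly_Mapping.keys p. Poly_Mapping.lookup p m * (\<Sum>i\<in>UNIV. w $ i *
        (real (Poly_Mapping.lookup m i) * monomial_at (m - Poly_Mapping.single i 1) x)))) (at x)"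
    by (intro has_derivative_sum has_derivative_mult_right has_derivative_monomial_at)
  also have "(\<lambda>x. \<Sum>m\<in>Poly_Mapping.keys p. Poly_Mapping.lookup p m * monomial_at m x) = eval_rpoly p"
    by (simp add: fun_eq_iff eval_rpoly_def monomial_at_def)
  also have "(\<lambda>w. \<Sum>m\<in>Poly_Mapping.keys p. Poly_Mapping.lookup p m * (\<Sum>i\<in>UNIV. w $ i *
        (real (Poly_Mapping.lookup m i) * monomial_at (m - Poly_Mapping.single i 1) x)))
      = (\<lambda>w. \<Sum>i\<in>UNIV. w $ i * eval_rpoly (partial_deriv i p) x)"
    unfolding partial_deriv_def eval_rpoly_sum eval_rpoly_single sum_distrib_left
    by (subst sum.swap) (simp add: mult_ac)
  finally show ?thesis .
qed

lemma real_polynomial_function_eval_rpoly: "real_polynomial_function (eval_rpoly p)"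
proof -
  have "real_polynomial_function (\<lambda>x. \<Sum>m\<in>Poly_Mapping.keys p. Poly_Mapping.lookup p m *
      (\<Prod>i\<in>UNIV. x $ i ^ Poly_Mapping.lookup m i))"
    by (intro real_polynomial_function_sum real_polynomial_function_prod
        real_polynomial_function_power real_polynomial_function.intros bounded_linear_vec_nth) auto
  then show ?thesis
    by (simp add: eval_rpoly_def[abs_def])
qed

lemma hessian_at_nth: "hessian_at p x $ i $ j = eval_rpoly (partial_deriv i (partial_deriv j p)) x"
  by (simp add: hessian_at_def hessian_def)

lemma transpose_hessian_at: "transpose (hessian_at p x) = hessian_at p x"
  by (simp add: vec_eq_iff transpose_def hessian_at_nth partial_deriv_commute)

lemma monomial_at_scaleR: "monomial_at m (r *\<^sub>R x) = r ^ total_deg m * monomial_at m x"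
  by (simp add: monomial_at_def total_deg_def power_mult_distrib prod.distrib power_sum)

lemma total_deg_minus_single:
  assumes "Poly_Mapping.lookup m i \<noteq> 0"
  shows "total_deg (m - Poly_Mapping.single i 1) + 1 = total_deg m"
proof -
  have "total_deg (m - Poly_Mapping.single i 1)
      = (Poly_Mapping.lookup m i - 1) + (\<Sum>j\<in>UNIV - {i}. Poly_Mapping.lookup m j)"
    unfolding total_deg_def
    by (subst sum.remove[of _ i]) (auto simp: lookup_minus lookup_single intro!: sum.cong)
  moreover have "total_deg m = Poly_Mapping.lookup m i + (\<Sum>j\<in>UNIV - {i}. Poly_Mapping.lookup m j)"
    unfolding total_deg_def by (rule sum.remove) auto
  ultimately show ?thesis
    using assms by simp
qed

text \<open>
  The contribution of the monomial \<open>m\<close> to an entry of the Hessian is homogeneous of degree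
  \<open>total_deg m - 2\<close>. The truncation of the subtraction is harmless because constants and linear
  monomials do not contribute.
\<close>

lemma hessian_at_scaleR:
  fixes p :: "'n::finite rpoly"
  obtains c where
    "\<And>r i j. hessian_at p (r *\<^sub>R x) $ i $ j
      = (\<Sum>m\<in>Poly_Mapping.keys p. r ^ (total_deg m - 2) * c m i j)"
    "\<And>m i j. total_deg m < 2 \<Longrightarrow> c m i j = 0"
proof
  define m' where "m' m i j = m - Poly_Mapping.single j 1 - Poly_Mapping.single i 1"
    for m :: "'n \<Rightarrow>\<^sub>0 nat" and i j
  define \<kappa> where "\<kappa> m i j = real (Poly_Mapping.lookup (m - Poly_Mapping.single j 1) i)
      * real (Poly_Mapping.lookup m j)" for m :: "'n \<Rightarrow>\<^sub>0 nat" and i j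
  define c where "c m i j = Poly_Mapping.lookup p m * \<kappa> m i j * monomial_at (m' m i j) x" for m i j
  have deg: "total_deg (m' m i j) + 2 = total_deg m" if "\<kappa> m i j \<noteq> 0" for m i j
    using that total_deg_minus_single[of m j]
      total_deg_minus_single[of "m - Poly_Mapping.single j 1" i]
    by (simp add: \<kappa>_def m'_def)
  show "c m i j = 0" if "total_deg m < 2" for m i j
    using deg[of m i j] that by (auto simp: c_def)
  show "hessian_at p (r *\<^sub>R x) $ i $ j
      = (\<Sum>m\<in>Poly_Mapping.keys p. r ^ (total_deg m - 2) * c m i j)" for r i j
  proof -
    have "hessian_at p (r *\<^sub>R x) $ i $ j
        = (\<Sum>m\<in>Poly_Mapping.keys p. Poly_Mapping.lookup p m * \<kappa> m i j * monomial_at (m' m i j) (r *\<^sub>R x))"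
      unfolding hessian_at_nth partial_deriv_def[of j p]
      by (simp add: partial_deriv_sum partial_deriv_single eval_rpoly_sum eval_rpoly_single
          \<kappa>_def m'_def mult_ac)
    also have "\<dots> = (\<Sum>m\<in>Poly_Mapping.keys p. r ^ (total_deg m - 2) * c m i j)"
    proof (rule sum.cong[OF refl])
      fix m
      show "Poly_Mapping.lookup p m * \<kappa> m i j * monomial_at (m' m i j) (r *\<^sub>R x)
          = r ^ (total_deg m - 2) * c m i j"
        using deg[of m i j, symmetric] by (cases "\<kappa> m i j = 0") (auto simp: c_def monomial_at_scaleR)
    qed
    finally show ?thesis .
  qed
qed

lemma lookup_hom_piece:
  "Poly_Mapping.lookup (hom_piece j p) m = (if total_deg m = j then Poly_Mapping.lookup p m else 0)"
  by (auto simp: hom_piece_def lookup_sum lookup_single when_def in_keys_iff)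

text \<open>
  The quadratic part gives the Hessian at \<open>0\<close>; all other monomials have degree at least \<open>d - k\<close>, so
  their contributions share the factor \<open>r ^ (d - k - 2)\<close>, and \<open>R\<close> collects what remains.
\<close>

lemma hessian_at_scaleR_gap:
  fixes p :: "'n::finite rpoly"
  assumes gap: "\<And>m. m \<in> Poly_Mapping.keys p \<Longrightarrow> total_deg m \<le> 2 \<or> total_deg m \<in> {d - k..d}"
    and d: "d \<ge> k + 3"
  obtains R :: "real poly ^ 'n ^ 'n" where "\<And>i j. degree (R $ i $ j) \<le> k"
    "\<And>r i j. hessian_at p (r *\<^sub>R x) $ i $ j = hessian_at p 0 $ i $ j + r ^ (d - k - 2) * poly (R $ i $ j) r"
proof -
  obtain c where c: "\<And>r i j. hessian_at p (r *\<^sub>R x) $ i $ j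
      = (\<Sum>m\<in>Poly_Mapping.keys p. r ^ (total_deg m - 2) * c m i j)"
    and c0: "\<And>m i j. total_deg m < 2 \<Longrightarrow> c m i j = 0"
    using hessian_at_scaleR[of p x] by blast
  define K where "K = {m \<in> Poly_Mapping.keys p. total_deg m \<in> {d - k..d}}"
  define L where "L = {m \<in> Poly_Mapping.keys p. total_deg m \<le> 2}"
  have split: "(\<Sum>m\<in>Poly_Mapping.keys p. f m) = (\<Sum>m\<in>L. f m) + (\<Sum>m\<in>K. f m)" for f :: "_ \<Rightarrow> real"
  proof -
    have "Poly_Mapping.keys p = L \<union> K" "L \<inter> K = {}" "finite L" "finite K"
      using gap d by (auto simp: K_def L_def)
    then show ?thesis by (simp add: sum.union_disjoint)
  qed
  define R where "R = (\<chi> i j. \<Sum>m\<in>K. monom (c m i j) (total_deg m - (d - k)))"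
  have low: "(\<Sum>m\<in>L. r ^ (total_deg m - 2) * c m i j) = hessian_at p 0 $ i $ j" for r i j
  proof -
    have "hessian_at p 0 $ i $ j = (\<Sum>m\<in>L. 0 ^ (total_deg m - 2) * c m i j)
        + (\<Sum>m\<in>K. 0 ^ (total_deg m - 2) * c m i j)"
      using c[of 0 i j] by (simp add: split)
    also have "(\<Sum>m\<in>K. 0 ^ (total_deg m - 2) * c m i j) = 0"
      using d by (auto simp: K_def zero_power intro!: sum.neutral)
    also have "(\<Sum>m\<in>L. 0 ^ (total_deg m - 2) * c m i j) = (\<Sum>m\<in>L. r ^ (total_deg m - 2) * c m i j)"
      by (rule sum.cong) (auto simp: L_def)
    finally show ?thesis by simp
  qed
  show thesis
  proof
    show "degree (R $ i $ j) \<le> k" for i j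
      unfolding R_def by (auto simp: K_def intro!: degree_sum_le order.trans[OF degree_monom_le])
    show "hessian_at p (r *\<^sub>R x) $ i $ j = hessian_at p 0 $ i $ j + r ^ (d - k - 2) * poly (R $ i $ j) r" for r i j
    proof -
      have "(\<Sum>m\<in>K. r ^ (total_deg m - 2) * c m i j)
          = (\<Sum>m\<in>K. r ^ (d - k - 2) * (r ^ (total_deg m - (d - k)) * c m i j))"
      proof (rule sum.cong[OF refl])
        fix m assume "m \<in> K"
        then have "total_deg m - 2 = (d - k - 2) + (total_deg m - (d - k))"
          using d by (auto simp: K_def)
        then show "r ^ (total_deg m - 2) * c m i j = r ^ (d - k - 2) * (r ^ (total_deg m - (d - k)) * c m i j)"
          by (simp add: power_add)
      qed
      also have "\<dots> = r ^ (d - k - 2) * poly (R $ i $ j) r"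
        by (simp add: R_def poly_sum poly_monom sum_distrib_left mult_ac)
      finally show ?thesis
        by (simp only: c split low)
    qed
  qed
qed

section \<open>Determinants of polynomial pencils\<close>

lemma det_ring_hom:
  fixes h :: "'a::comm_ring_1 \<Rightarrow> 'b::comm_ring_1" and M :: "'a ^ 'n ^ 'n"
  assumes add: "\<And>x y. h (x + y) = h x + h y" and mult: "\<And>x y. h (x * y) = h x * h y"
    and one: "h 1 = 1"
  shows "h (det M) = det (\<chi> i j. h (M $ i $ j))"
proof -
  have zero: "h 0 = 0"
    using add[of 0 0] by simp
  have minus: "h (- x) = - h x" for x
    using add[of x "- x"] by (simp add: zero eq_neg_iff_add_eq_0 add.commute)
  have sign: "h (of_int (sign p)) = of_int (sign p)" for p :: "'n \<Rightarrow> 'n"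
    by (simp add: sign_def one minus)
  have sum: "h (sum f A) = (\<Sum>x\<in>A. h (f x))" for f :: "('n \<Rightarrow> 'n) \<Rightarrow> 'a" and A
    by (induction A rule: infinite_finite_induct) (simp_all add: zero add)
  have prod: "h (prod f A) = (\<Prod>x\<in>A. h (f x))" for f :: "'n \<Rightarrow> 'a" and A
    by (induction A rule: infinite_finite_induct) (simp_all add: one mult)
  show ?thesis
    by (simp add: det_def sum mult sign prod)
qed

text \<open>
  For \<open>P\<close> a polynomial in \<open>t\<close> over the polynomials in \<open>r\<close>: the coefficient of \<open>t\<^sup>j\<close> has degree at most \<open>j k\<close>
  in \<open>r\<close>. These polynomials form a subring, which contains \<open>a + t R(r)\<close> if \<open>R\<close> has degree at most \<open>k\<close>.
\<close>

definition weighted :: "nat \<Rightarrow> 'a::comm_ring_1 poly poly \<Rightarrow> bool" where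
  "weighted k P \<longleftrightarrow> (\<forall>j. degree (coeff P j) \<le> j * k)"

lemma weighted_sum: "(\<And>x. x \<in> A \<Longrightarrow> weighted k (f x)) \<Longrightarrow> weighted k (sum f A)"
  by (induction A rule: infinite_finite_induct) (auto simp: weighted_def intro: degree_add_le)

lemma weighted_mult:
  assumes "weighted k P" "weighted k Q"
  shows "weighted k (P * Q)"
  unfolding weighted_def
proof
  fix j
  have "degree (coeff P i * coeff Q (j - i)) \<le> j * k" if "i \<le> j" for i
  proof -
    have "degree (coeff P i * coeff Q (j - i)) \<le> degree (coeff P i) + degree (coeff Q (j - i))"
      by (rule degree_mult_le)
    also have "\<dots> \<le> i * k + (j - i) * k"
      using assms by (intro add_mono) (auto simp: weighted_def)
    also have "\<dots> = j * k"
      using that by (simp flip: add_mult_distrib)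
    finally show ?thesis .
  qed
  then show "degree (coeff (P * Q) j) \<le> j * k"
    unfolding coeff_mult by (intro degree_sum_le) auto
qed

lemma weighted_prod: "(\<And>x. x \<in> A \<Longrightarrow> weighted k (f x)) \<Longrightarrow> weighted k (prod f A)"
  by (induction A rule: infinite_finite_induct) (auto simp: weighted_def[of _ 1] intro: weighted_mult)

lemma weighted_det:
  fixes M :: "'a::comm_ring_1 poly poly ^ 'n ^ 'n"
  assumes "\<And>i j. weighted k (M $ i $ j)"
  shows "weighted k (det M)"
proof -
  have sign: "weighted k (of_int (sign p))" for p :: "'n \<Rightarrow> 'n"
    by (simp add: weighted_def sign_def)
  show ?thesis
    unfolding det_def by (intro weighted_sum weighted_mult weighted_prod assms sign)
qed

lemma degree_det_le:
  fixes M :: "'a::comm_ring_1 poly ^ 'n ^ 'n"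
  assumes "\<And>i j. degree (M $ i $ j) \<le> 1"
  shows "degree (det M) \<le> CARD('n)"
  unfolding det_def
proof (rule degree_sum_le)
  fix p assume "p \<in> {p. p permutes (UNIV :: 'n set)}"
  have "degree (of_int (sign p) * (\<Prod>i\<in>UNIV. M $ i $ p i)) \<le> 0 + degree (\<Prod>i\<in>UNIV. M $ i $ p i)"
    by (rule order.trans[OF degree_mult_le]) (simp add: sign_def)
  also have "\<dots> \<le> sum (degree \<circ> (\<lambda>i. M $ i $ p i)) UNIV"
    using degree_prod_sum_le[of UNIV "\<lambda>i. M $ i $ p i"] by simp
  also have "\<dots> \<le> (\<Sum>i\<in>(UNIV :: 'n set). 1)"
    by (rule sum_mono) (simp only: o_apply assms)
  finally show "degree (of_int (sign p) * (\<Prod>i\<in>UNIV. M $ i $ p i)) \<le> CARD('n)"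
    by simp
qed simp

text \<open>
  Expand \<open>det (A + t R(r)) = \<Sum>j\<le>n. t\<^sup>j c\<^sub>j(r)\<close>, where \<open>c\<^sub>j\<close> has degree at most \<open>j k\<close>. Substituting \<open>t = r\<^sup>m\<close>
  gives terms whose exponents in \<open>r\<close> lie between \<open>m j\<close> and \<open>m j + j k\<close>. As \<open>j k < m\<close> for \<open>j < n\<close>,
  these ranges are disjoint for different \<open>j\<close>, so nothing can cancel in the sum; since the sum is
  constant, each \<open>c\<^sub>j\<close> with \<open>j \<ge> 1\<close> vanishes.
\<close>

lemma det_pencil_constant:
  fixes A :: "real ^ 'n ^ 'n" and R :: "real poly ^ 'n ^ 'n"
  assumes deg: "\<And>i j. degree (R $ i $ j) \<le> k" and m: "m > (CARD('n) - 1) * k"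
    and const: "\<And>r. det (\<chi> i j. A $ i $ j + r ^ m * poly (R $ i $ j) r) = \<delta>"
  shows "det (\<chi> i j. A $ i $ j + t * poly (R $ i $ j) 1) = \<delta>"
proof -
  define M :: "real poly poly ^ 'n ^ 'n" where "M = (\<chi> i j. [:[:A $ i $ j:], R $ i $ j:])"
  define C where "C = det M"
  have eval: "poly (poly C q) r = det (\<chi> i j. A $ i $ j + poly q r * poly (R $ i $ j) r)" for q r
    unfolding C_def by (subst det_ring_hom[where h = "\<lambda>P. poly (poly P q) r"]) (simp_all add: M_def)
  have wt: "degree (coeff C j) \<le> j * k" for j
  proof -
    have "weighted k C"
      unfolding C_def by (rule weighted_det) (auto simp: weighted_def M_def coeff_pCons deg split: nat.split)
    then show ?thesis by (simp add: weighted_def)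
  qed
  have degC: "degree C \<le> CARD('n)"
    unfolding C_def by (rule degree_det_le) (simp add: M_def)
  have "poly C (monom 1 m) = [:\<delta>:]"
    by (rule poly_eq_poly_eq_iff[THEN iffD1]) (simp add: fun_eq_iff eval poly_monom const)
  then have expansion: "(\<Sum>l\<le>degree C. monom 1 (m * l) * coeff C l) = [:\<delta>:]"
    by (simp add: poly_altdef monom_power mult.commute)
  have "coeff (coeff C j) i = 0" if "j \<ge> 1" for i j
  proof (cases "j \<le> degree C \<and> i \<le> j * k")
    case True
    \<comment> \<open>The monomial \<open>r ^ (m j + i)\<close> occurs in the range of \<open>j\<close> only.\<close>
    have other: "coeff (monom 1 (m * l) * coeff C l) (m * j + i) = 0"
      if l: "l \<le> degree C" "l \<noteq> j" for l
    proof (cases "l < j")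
      case True
      then have "l * k \<le> (CARD('n) - 1) * k"
        using degC \<open>j \<le> degree C \<and> i \<le> j * k\<close> by (intro mult_right_mono) auto
      also have "\<dots> < m" by (rule m)
      also have "m \<le> m * (j - l)"
        using True by (simp add: Suc_le_eq)
      also have "\<dots> \<le> m * j + i - m * l"
        by (simp add: right_diff_distrib')
      finally have "coeff (coeff C l) (m * j + i - m * l) = 0"
        using wt[of l] by (intro coeff_eq_0) auto
      then show ?thesis
        by (simp add: coeff_monom_mult)
    next
      case False
      then have "j < l" using l by simp
      then have "j * k \<le> (CARD('n) - 1) * k"
        using degC l by (intro mult_right_mono) auto
      then have "i < m"
        using m True by linarith
      also have "m \<le> m * (l - j)"
        using \<open>j < l\<close> by (simp add: Suc_le_eq)
      finally have "m * j + i < m * l"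
        by (simp add: right_diff_distrib')
      then show ?thesis
        by (simp add: coeff_monom_mult)
    qed
    have "coeff (\<Sum>l\<le>degree C. monom 1 (m * l) * coeff C l) (m * j + i)
        = (\<Sum>l\<in>{j}. coeff (monom 1 (m * l) * coeff C l) (m * j + i))"
      unfolding coeff_sum by (rule sum.mono_neutral_right) (use True other in auto)
    also have "\<dots> = coeff (coeff C j) i"
      by (simp add: coeff_monom_mult)
    finally have "coeff (coeff C j) i = coeff [:\<delta>:] (m * j + i)"
      by (simp only: expansion)
    also have "\<dots> = 0"
      using m that by (simp add: coeff_pCons split: nat.split)
    finally show ?thesis .
  next
    case False
    then show ?thesis
      using wt[of j] by (auto intro: coeff_eq_0 simp: coeff_eq_0)
  qed
  then have "coeff C j = 0" if "j \<ge> 1" for j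
    using that by (simp add: poly_eq_iff)
  then have "degree C = 0"
    by (metis leading_coeff_0_iff less_one not_le degree_0)
  then obtain c where "C = [:c:]"
    by (rule degree_eq_zeroE)
  then have "poly (poly C [:t:]) 1 = poly (poly C [:1:]) 1"
    by simp
  then show ?thesis
    using const[of 1] by (simp add: eval)
qed

text \<open>
  By Cramer's rule the solution of \<open>(A + t S) x = A p\<close> is polynomial in \<open>t\<close>, since the determinant in the
  denominator is constant. Comparing coefficients, the coefficient of \<open>t\<^sup>l\<close> is \<open>(- B S)\<^sup>l p\<close> with \<open>B\<close> the
  inverse of \<open>A\<close>, and it vanishes for large \<open>l\<close>.
\<close>

lemma nilpotent_of_det_pencil_constant:
  fixes A B S :: "real ^ 'n ^ 'n"
  assumes A: "det A \<noteq> 0" and B: "B ** A = mat 1"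
    and const: "\<And>t. det (\<chi> i j. A $ i $ j + t * S $ i $ j) = det A"
  shows "\<exists>l. ((\<lambda>p. B *v (S *v p)) ^^ l) p = 0"
proof -
  define b where "b = A *v p"
  define X :: "'n \<Rightarrow> real poly" where "X = (\<lambda>k. smult (1 / det A)
    (det (\<chi> i j. if j = k then [:b $ i:] else [:A $ i $ j, S $ i $ j:])))"
  define y where "y = (\<lambda>l. \<chi> k. coeff (X k) l)"
  have X: "poly (X k) t = det (\<chi> i j. if j = k then b $ i else A $ i $ j + t * S $ i $ j) / det A" for k t
    unfolding X_def
    by (simp, subst det_ring_hom[where h = "\<lambda>P. poly P t"]) (simp_all add: if_distrib[of "\<lambda>P. poly P t"] cong: if_cong)
  have solution: "(\<chi> i j. A $ i $ j + t * S $ i $ j) *v (\<chi> k. poly (X k) t) = b" for t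
    by (subst cramer) (simp_all add: const A X cong: if_cong)
  have "(\<Sum>k\<in>UNIV. [:A $ i $ k, S $ i $ k:] * X k) = [:b $ i:]" for i
  proof (rule poly_eq_poly_eq_iff[THEN iffD1], rule ext)
    fix t
    show "poly (\<Sum>k\<in>UNIV. [:A $ i $ k, S $ i $ k:] * X k) t = poly [:b $ i:] t"
      using solution[of t] by (simp add: vec_eq_iff matrix_vector_mult_def poly_sum algebra_simps)
  qed
  then have coeffs: "(\<Sum>k\<in>UNIV. coeff ([:A $ i $ k, S $ i $ k:] * X k) l) = coeff [:b $ i:] l" for i l
    by (simp only: coeff_sum[symmetric])
  have cancel: "q = q'" if "A *v q = A *v q'" for q q'
    using B that by (metis matrix_vector_mul_assoc matrix_vector_mul_lid)
  have AB: "A *v (B *v q) = q" for q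
    using B by (metis matrix_left_right_inverse matrix_vector_mul_assoc matrix_vector_mul_lid)
  have coeff0: "(\<Sum>k\<in>UNIV. A $ i $ k * coeff (X k) 0) = b $ i" for i
    using coeffs[of i 0] by (simp add: coeff_mult_0)
  have coeffS: "(\<Sum>k\<in>UNIV. A $ i $ k * coeff (X k) (Suc l)) + (\<Sum>k\<in>UNIV. S $ i $ k * coeff (X k) l) = 0"
    for i l
    using coeffs[of i "Suc l"] by (simp add: sum.distrib)
  have "A *v y 0 = A *v p"
    unfolding b_def[symmetric] by (simp add: vec_eq_iff y_def coeff0 matrix_vector_mult_def[of A])
  then have "y 0 = p"
    by (rule cancel)
  have step: "y (Suc l) = - (B *v (S *v y l))" for l
  proof (rule cancel)
    have "A *v y (Suc l) + S *v y l = 0"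
      by (simp add: vec_eq_iff matrix_vector_mult_def y_def coeffS)
    then show "A *v y (Suc l) = A *v - (B *v (S *v y l))"
      by (simp add: linear_neg[OF matrix_vector_mul_linear] AB eq_neg_iff_add_eq_0)
  qed
  have y: "y l = (- 1) ^ l *\<^sub>R ((\<lambda>p. B *v (S *v p)) ^^ l) p" for l
  proof (induction l)
    case 0
    then show ?case using \<open>y 0 = p\<close> by simp
  next
    case (Suc l)
    then show ?case
      by (simp add: step matrix_vector_mult_scaleR)
  qed
  define l where "l = Suc (\<Sum>k\<in>UNIV. degree (X k))"
  have "degree (X k) < l" for k
    unfolding l_def by (intro le_imp_less_Suc member_le_sum) auto
  then have "y l = 0"
    by (simp add: y_def vec_eq_iff coeff_eq_0)
  then show ?thesis
    using y[of l] by auto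
qed

section \<open>Symmetric matrices of index at most one\<close>

lemma symmetric_inner_swap:
  fixes A :: "real ^ 'n ^ 'n"
  assumes "transpose A = A"
  shows "p \<bullet> (A *v q) = (A *v p) \<bullet> q"
  using assms by (metis dot_lmul_matrix transpose_matrix_vector)

text \<open>
  A minimizer \<open>u\<close> of the Rayleigh quotient on the unit sphere of \<open>V\<close>: for each \<open>z \<in> V\<close> the quadratic polynomial
  \<open>t \<mapsto> Q (u + t z)\<close>, with \<open>Q w = w \<bullet> A w - l (w \<bullet> w)\<close>, is nonnegative and zero at \<open>t = 0\<close>, so its
  linear coefficient \<open>2 z \<bullet> (A u - l u)\<close> is zero.
\<close>

lemma least_eigenvalue_on_subspace:
  fixes A :: "real ^ 'n ^ 'n"
  assumes sym: "transpose A = A" and V: "subspace V" "V \<noteq> {0}"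
    and invariant: "\<And>p. p \<in> V \<Longrightarrow> A *v p \<in> V"
  obtains u l where "u \<in> V" "u \<noteq> 0" "A *v u = l *\<^sub>R u"
    "\<And>w. w \<in> V \<Longrightarrow> w \<bullet> (A *v w) \<ge> l * (w \<bullet> w)"
proof -
  let ?K = "V \<inter> sphere 0 1"
  have "compact ?K"
    using closed_subspace[OF V(1)] by (auto simp: Int_commute intro: closed_Int_compact)
  moreover obtain z where "z \<in> V" "z \<noteq> 0"
    using V subspace_0 by blast
  then have "z /\<^sub>R norm z \<in> ?K"
    using V(1) by (simp add: subspace_scale)
  moreover have "continuous_on ?K (\<lambda>w. w \<bullet> (A *v w))"
    by (intro continuous_intros linear_continuous_on matrix_vector_mul_bounded_linear)
  ultimately obtain u where u: "u \<in> ?K" and min: "\<And>w. w \<in> ?K \<Longrightarrow> u \<bullet> (A *v u) \<le> w \<bullet> (A *v w)"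
    using continuous_attains_inf[of ?K "\<lambda>w. w \<bullet> (A *v w)"] by blast
  define l where "l = u \<bullet> (A *v u)"
  have uu: "u \<bullet> u = 1" and "u \<in> V"
    using u by (auto simp: norm_eq_1)
  have bound: "w \<bullet> (A *v w) \<ge> l * (w \<bullet> w)" if "w \<in> V" for w
  proof (cases "w = 0")
    case False
    have "w /\<^sub>R norm w \<in> ?K"
      using V(1) that False by (simp add: subspace_scale)
    from min[OF this] have "l \<le> (w \<bullet> (A *v w)) / (norm w)\<^sup>2"
      by (simp add: l_def matrix_vector_mult_scaleR power2_eq_square divide_simps)
    then show ?thesis
      using False by (simp add: power2_norm_eq_inner field_simps)
  qed simp
  have "z \<bullet> (A *v u - l *\<^sub>R u) = 0" if "z \<in> V" for z
  proof -
    define b where "b = z \<bullet> (A *v u - l *\<^sub>R u)"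
    define a where "a = z \<bullet> (A *v z) - l * (z \<bullet> z)"
    have "a * t ^ 2 + 2 * b * t \<ge> 0" for t
    proof -
      have "u + t *\<^sub>R z \<in> V"
        using \<open>u \<in> V\<close> that V(1) by (simp add: subspace_add subspace_scale)
      from bound[OF this] show ?thesis
        using symmetric_inner_swap[OF sym, of u z] uu
        by (simp add: a_def b_def l_def matrix_vector_right_distrib matrix_vector_mult_scaleR
            inner_simps inner_commute power2_eq_square algebra_simps)
    qed
    note quadratic = this
    \<comment> \<open>At \<open>t = - s\<close> the linear term \<open>2 b t\<close> outweighs \<open>a t\<^sup>2\<close> unless \<open>b = 0\<close>.\<close>
    define s where "s = b / (\<bar>a\<bar> + 1)"
    have b: "b = s * (\<bar>a\<bar> + 1)"
      by (simp add: s_def add_nonneg_eq_0_iff)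
    have "s ^ 2 * (a - 2 * (\<bar>a\<bar> + 1)) = a * (- s) ^ 2 + 2 * b * (- s)"
      by (simp add: b algebra_simps power2_eq_square)
    also have "\<dots> \<ge> 0"
      by (rule quadratic)
    finally have "0 \<le> s ^ 2 * (a - 2 * (\<bar>a\<bar> + 1))" .
    moreover have "a - 2 * (\<bar>a\<bar> + 1) < 0"
      by (simp add: abs_if)
    ultimately have "s = 0"
      by (simp add: zero_le_mult_iff)
    then have "b = 0"
      by (simp add: b)
    then show ?thesis by (simp add: b_def)
  qed
  from this[of "A *v u - l *\<^sub>R u"] have "A *v u = l *\<^sub>R u"
    using invariant[OF \<open>u \<in> V\<close>] \<open>u \<in> V\<close> V(1) by (simp add: subspace_diff subspace_scale)
  moreover have "u \<noteq> 0"
    using uu by auto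
  ultimately show thesis
    using that[of u l] \<open>u \<in> V\<close> bound by blast
qed

lemma invertible_matrix_with_rows:
  fixes e u :: "real ^ 'n"
  assumes "independent {e, u}" "e \<noteq> u"
  obtains P :: "real ^ 'n ^ 'n" and a b where "det P \<noteq> 0" "a \<noteq> b" "P $ a = e" "P $ b = u"
proof -
  obtain B where B: "{e, u} \<subseteq> B" "independent B" "UNIV \<subseteq> span B"
    using maximal_independent_subset_extend[of "{e, u}" UNIV] assms(1) by auto
  have "card B = CARD('n)"
    using B by (metis basis_card_eq_dim dim_UNIV DIM_cart DIM_real mult.right_neutral subset_UNIV)
  moreover have "finite B"
    using B(2) by (rule independent_imp_finite)
  ultimately obtain f where f: "bij_betw f (UNIV :: 'n set) B"
    using finite_same_card_bij by (metis finite_class.finite_UNIV)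
  then obtain a b where ab: "f a = e" "f b = u"
    using B(1) by (metis bij_betw_iff_bijections insert_subset)
  define P :: "real ^ 'n ^ 'n" where "P = (\<chi> i. f i)"
  have "rows P = B"
    using f by (auto simp: rows_def row_def P_def vec_nth_inverse bij_betw_def image_def)
  then have "invertible P"
    using B(3) matrix_left_invertible_span_rows[of P] invertible_left_inverse[of P] by blast
  then have "det P \<noteq> 0"
    by (simp add: invertible_det_nz)
  then show thesis
    using that[of P a b] ab assms(2) by (auto simp: P_def)
qed

text \<open>
  Multiplying \<open>x I - A\<close> from the left by an invertible constant matrix with rows \<open>e\<close> and \<open>u\<close> produces two rows
  that are divisible by \<open>x - l1\<close> and \<open>x - l2\<close>. For \<open>l1 = l2\<close> this shows that the algebraic multiplicity
  is at least two.
\<close>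

lemma charpoly_dvd_of_eigenvectors:
  fixes A :: "real ^ 'n ^ 'n"
  assumes sym: "transpose A = A" and e: "A *v e = l1 *\<^sub>R e" and u: "A *v u = l2 *\<^sub>R u"
    and ind: "independent {e, u}" "e \<noteq> u"
  shows "[:- l1, 1:] * [:- l2, 1:] dvd charpoly A"
proof -
  obtain P :: "real ^ 'n ^ 'n" and a b where P: "det P \<noteq> 0" "a \<noteq> b" "P $ a = e" "P $ b = u"
    using invertible_matrix_with_rows[OF ind] .
  define M :: "real poly ^ 'n ^ 'n" where
    "M = (\<chi> i j. (if i = j then [:0, 1:] else 0) - [:A $ i $ j:])"
  define Q :: "real poly ^ 'n ^ 'n" where "Q = (\<chi> i j. [:P $ i $ j:])"
  have row: "(Q ** M) $ c $ j = [:- l, 1:] * [:P $ c $ j:]" if "A *v (P $ c) = l *\<^sub>R (P $ c)" for c l j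
  proof -
    have "A $ k $ j = A $ j $ k" for k
      using sym by (metis transpose_def vec_lambda_beta)
    then have "(\<Sum>k\<in>UNIV. P $ c $ k * A $ k $ j) = l * P $ c $ j"
      using that by (simp add: vec_eq_iff matrix_vector_mult_def mult.commute)
    then have *: "(\<Sum>k\<in>UNIV. [:P $ c $ k * A $ k $ j:]) = [:l * P $ c $ j:]"
      by (simp add: poly_eq_iff coeff_sum coeff_pCons split: nat.split)
    have "(Q ** M) $ c $ j = (\<Sum>k\<in>UNIV. (if k = j then [:P $ c $ k:] * [:0, 1:] else 0)
        - [:P $ c $ k * A $ k $ j:])"
      by (simp add: matrix_matrix_mult_def Q_def M_def) (rule sum.cong, auto simp: right_diff_distrib)
    also have "\<dots> = [:P $ c $ j:] * [:0, 1:] - [:l * P $ c $ j:]"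
      by (simp add: sum_subtractf *)
    finally show ?thesis by simp
  qed
  have dvd_row: "[:- l, 1:] dvd (Q ** M) $ c $ j" if "A *v (P $ c) = l *\<^sub>R (P $ c)" for c l j
    unfolding row[OF that] by (rule dvd_triv_left)
  have dvd_a: "[:- l1, 1:] dvd (Q ** M) $ a $ j" and dvd_b: "[:- l2, 1:] dvd (Q ** M) $ b $ j" for j
    using dvd_row[of a l1] dvd_row[of b l2] e u P by simp_all
  have "[:- l1, 1:] * [:- l2, 1:] dvd det (Q ** M)"
    unfolding det_def
  proof (intro dvd_sum dvd_mult)
    fix p
    have "(\<Prod>i\<in>UNIV. (Q ** M) $ i $ p i)
        = (Q ** M) $ a $ p a * ((Q ** M) $ b $ p b * (\<Prod>i\<in>UNIV - {a} - {b}. (Q ** M) $ i $ p i))"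
      using P(2) by (simp add: prod.remove[of UNIV a] prod.remove[of "UNIV - {a}" b])
    then show "[:- l1, 1:] * [:- l2, 1:] dvd (\<Prod>i\<in>UNIV. (Q ** M) $ i $ p i)"
      by (simp only: mult.assoc[symmetric]) (rule dvd_mult2[OF mult_dvd_mono[OF dvd_a dvd_b]])
  qed
  also have "det (Q ** M) = [:det P:] * charpoly A"
  proof -
    have "[:det P:] = det Q"
      unfolding Q_def by (rule det_ring_hom) (simp_all add: one_pCons)
    then show ?thesis
      by (simp add: det_mul charpoly_def M_def)
  qed
  finally show ?thesis
    using P(1) by (simp add: dvd_smult_iff)
qed

lemma charpoly_nonzero:
  fixes A :: "real ^ 'n ^ 'n"
  assumes "det A \<noteq> 0"
  shows "charpoly A \<noteq> 0"
proof
  assume "charpoly A = 0"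
  then have "0 = poly (charpoly A) 0" by simp
  also have "\<dots> = det (- A)"
    unfolding charpoly_def
    by (subst det_ring_hom[where h = "\<lambda>P. poly P 0"])
      (simp_all add: vec_eq_iff arg_cong[where f = det])
  finally have "\<not> invertible (- A)"
    by (simp add: invertible_det_nz)
  moreover obtain B where "A ** B = mat 1" "B ** A = mat 1"
    using assms by (auto simp: invertible_def simp flip: invertible_det_nz)
  then have "- A ** - B = mat 1" "- B ** - A = mat 1"
    by (simp_all add: matrix_matrix_mult_def vec_eq_iff)
  ultimately show False
    unfolding invertible_def by blast
qed

text \<open>
  Take \<open>e\<close> to be an eigenvector for the least eigenvalue. The least eigenvalue on its complement is nonzero,
  and if it were negative, then so would be the one of \<open>e\<close>, and the index would be at least two.
\<close>

lemma index_le_1_imp_positive_complement: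
  fixes A :: "real ^ 'n ^ 'n"
  assumes sym: "transpose A = A" and det: "det A \<noteq> 0" and index: "matrix_index A \<le> 1"
  obtains e where "e \<noteq> 0" "\<And>w. w \<bullet> (A *v e) = 0 \<Longrightarrow> w \<noteq> 0 \<Longrightarrow> w \<bullet> (A *v w) > 0"
proof -
  have kernel: "p = 0" if "A *v p = 0" for p
    using det that by (metis invertible_det_nz invertible_def matrix_vector_mul_assoc
        matrix_vector_mul_lid matrix_vector_mult_0_right)
  obtain e l1 where e: "e \<noteq> 0" "A *v e = l1 *\<^sub>R e" and min1: "\<And>w. w \<bullet> (A *v w) \<ge> l1 * (w \<bullet> w)"
    using least_eigenvalue_on_subspace[OF sym subspace_UNIV] by (metis UNIV_I UNIV_not_singleton)
  have "l1 \<noteq> 0"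
    using e kernel by auto
  define V where "V = {w. w \<bullet> e = 0}"
  have V: "subspace V"
    unfolding V_def by (auto simp: subspace_def inner_simps)
  have inv: "A *v w \<in> V" if "w \<in> V" for w
    using that symmetric_inner_swap[OF sym, of w e] by (simp add: V_def e)
  have "w \<bullet> (A *v w) > 0" if w: "w \<in> V" "w \<noteq> 0" for w
  proof -
    have "V \<noteq> {0}" using w by blast
    then obtain u l2 where u: "u \<in> V" "u \<noteq> 0" "A *v u = l2 *\<^sub>R u"
      and min2: "\<And>w. w \<in> V \<Longrightarrow> w \<bullet> (A *v w) \<ge> l2 * (w \<bullet> w)"
      using least_eigenvalue_on_subspace[OF sym V _ inv] by metis
    have "l2 \<noteq> 0"
      using u kernel by auto
    moreover have "\<not> l2 < 0"
    proof
      assume "l2 < 0"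
      have "l1 * (u \<bullet> u) \<le> l2 * (u \<bullet> u)"
        using min1[of u] by (simp add: u)
      then have "l1 \<le> l2"
        using u(2) by simp
      have "e \<noteq> u"
        using u e by (auto simp: V_def)
      moreover have "independent {e, u}"
        by (rule pairwise_orthogonal_independent)
          (use u e in \<open>auto simp: V_def pairwise_def orthogonal_def inner_commute\<close>)
      ultimately have dvd: "[:- l1, 1:] * [:- l2, 1:] dvd charpoly A"
        by (intro charpoly_dvd_of_eigenvectors[OF sym e(2) u(3)])
      have nz: "charpoly A \<noteq> 0"
        by (rule charpoly_nonzero[OF det])
      let ?R = "{l. l < 0 \<and> poly (charpoly A) l = 0}"
      have fin: "finite ?R"
        using poly_roots_finite[OF nz] by (rule rev_finite_subset) auto
      have roots: "poly (charpoly A) l1 = 0" "poly (charpoly A) l2 = 0"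
        using dvd_mult_left[OF dvd] dvd_mult_right[OF dvd] by (simp_all only: poly_eq_0_iff_dvd)
      have sub: "(\<Sum>l\<in>S. order l (charpoly A)) \<le> matrix_index A" if "S \<subseteq> ?R" for S
        unfolding matrix_index_def by (rule sum_mono2[OF fin that]) simp
      show False
      proof (cases "l1 = l2")
        case True
        have "[:- l1, 1:] ^ 2 dvd charpoly A"
          using dvd True by (simp add: power2_eq_square)
        then have "2 \<le> order l1 (charpoly A)"
          using nz order_divides by blast
        with sub[of "{l1}"] show False
          using index roots \<open>l2 < 0\<close> True by simp
      next
        case False
        have "order l1 (charpoly A) \<noteq> 0" "order l2 (charpoly A) \<noteq> 0"
          using roots nz by (simp_all add: order_root)
        with sub[of "{l1, l2}"] show False
          using index roots \<open>l2 < 0\<close> \<open>l1 \<le> l2\<close> False by simp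
      qed
    qed
    ultimately have "l2 * (w \<bullet> w) > 0"
      using w by simp
    then show ?thesis
      using min2[OF w(1)] by linarith
  qed
  then show thesis
    using that[of e] e \<open>l1 \<noteq> 0\<close> by (simp add: V_def)
qed

section \<open>Constant pivots\<close>

definition hessian_deriv_at :: "'n::finite rpoly \<Rightarrow> real ^ 'n \<Rightarrow> real ^ 'n \<Rightarrow> real ^ 'n ^ 'n" where
  "hessian_deriv_at p x w = (\<chi> i j. \<Sum>k\<in>UNIV. w $ k *
     eval_rpoly (partial_deriv k (partial_deriv i (partial_deriv j p))) x)"

lemma hessian_deriv_at_commute:
  "hessian_deriv_at p x w *v q = hessian_deriv_at p x q *v w"
proof -
  have "(\<Sum>j\<in>UNIV. \<Sum>k\<in>UNIV. w $ k * eval_rpoly (partial_deriv k (partial_deriv i (partial_deriv j p))) x * q $ j)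
    = (\<Sum>j\<in>UNIV. \<Sum>k\<in>UNIV. q $ k * eval_rpoly (partial_deriv k (partial_deriv i (partial_deriv j p))) x * w $ j)" for i
  proof (subst sum.swap, intro sum.cong refl)
    fix k j
    have "partial_deriv k (partial_deriv i (partial_deriv j p))
        = partial_deriv j (partial_deriv i (partial_deriv k p))"
      by (metis partial_deriv_commute)
    then show "w $ k * eval_rpoly (partial_deriv k (partial_deriv i (partial_deriv j p))) x * q $ j
        = q $ j * eval_rpoly (partial_deriv j (partial_deriv i (partial_deriv k p))) x * w $ k"
      by simp
  qed
  then show ?thesis
    by (simp add: vec_eq_iff matrix_vector_mult_def hessian_deriv_at_def sum_distrib_right)
qed

lemma has_derivative_hessian_at_mult:
  fixes p :: "'n::finite rpoly"
  shows "((\<lambda>x. hessian_at p x *v q) has_derivative (\<lambda>w. hessian_deriv_at p x w *v q)) (at x)"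
proof (rule has_derivative_componentwise_within[THEN iffD2], rule ballI)
  fix b :: "real ^ 'n" assume "b \<in> Basis"
  then obtain i where b: "b = axis i 1"
    by (auto simp: Basis_vec_def)
  have "((\<lambda>x. \<Sum>j\<in>UNIV. hessian_at p x $ i $ j * q $ j) has_derivative
      (\<lambda>w. \<Sum>j\<in>UNIV. hessian_deriv_at p x w $ i $ j * q $ j)) (at x)"
    unfolding hessian_at_nth hessian_deriv_at_def vec_lambda_beta
    by (intro has_derivative_sum has_derivative_mult_left has_derivative_eval_rpoly)
  then show "((\<lambda>x. (hessian_at p x *v q) \<bullet> b) has_derivative
      (\<lambda>w. (hessian_deriv_at p x w *v q) \<bullet> b)) (at x)"
    by (simp add: b inner_axis matrix_vector_mult_def)
qed

lemma polynomial_function_matrix_mult: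
  fixes M :: "real ^ 'm \<Rightarrow> real ^ 'n ^ 'k"
  assumes "\<And>i j. real_polynomial_function (\<lambda>x. M x $ i $ j)"
  shows "polynomial_function (\<lambda>x. M x *v q)"
  unfolding polynomial_function_iff_Basis_inner
proof
  fix b :: "real ^ 'k" assume "b \<in> Basis"
  then obtain i where b: "b = axis i 1"
    by (auto simp: Basis_vec_def)
  have "real_polynomial_function (\<lambda>x. \<Sum>j\<in>UNIV. M x $ i $ j * q $ j)"
    by (intro real_polynomial_function_sum real_polynomial_function.intros(2,4) assms) simp
  then show "real_polynomial_function (\<lambda>x. (M x *v q) \<bullet> b)"
    by (simp add: b inner_axis matrix_vector_mult_def)
qed

lemma polynomial_function_matrix_const_mult:
  fixes B :: "real ^ 'n ^ 'k"
  assumes "polynomial_function f"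
  shows "polynomial_function (\<lambda>x. B *v f x)"
  using polynomial_function_compose[OF assms
      polynomial_function_bounded_linear[OF matrix_vector_mul_bounded_linear[of B]]]
  by (simp add: o_def)

text \<open>
  The bound \<open>d \<ge> n k + 3\<close>, with \<open>n\<close> the number of variables, is what \<open>det_pencil_constant\<close> requires: with \<open>m = d - k - 2\<close>
  it says \<open>m > (n - 1) k\<close>.
\<close>

theorem constant_pivot_of_gap:
  fixes \<phi> :: "'n::finite rpoly"
  assumes det: "\<And>x. det (hessian_at \<phi> x) = \<delta>" and \<delta>: "\<delta> \<noteq> 0"
    and index: "matrix_index (hessian_at \<phi> 0) \<le> 1"
    and gap: "\<And>m. m \<in> Poly_Mapping.keys \<phi> \<Longrightarrow> total_deg m \<le> 2 \<or> total_deg m \<in> {d - k..d}"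
    and d: "d \<ge> CARD('n) * k + 3"
  shows "\<exists>\<xi>. constant_pivot \<phi> \<xi>"
proof -
  define A where "A = hessian_at \<phi> 0"
  have symA: "transpose A = A"
    by (simp add: A_def transpose_hessian_at)
  have detA: "det A \<noteq> 0"
    using det \<delta> by (simp add: A_def)
  then obtain B where B: "B ** A = mat 1" "A ** B = mat 1"
    by (auto simp: invertible_def simp flip: invertible_det_nz)
  have AB: "A *v (B *v q) = q" for q
    using B(2) by (metis matrix_vector_mul_assoc matrix_vector_mul_lid)
  have BA: "B *v (A *v q) = q" for q
    using B(1) by (metis matrix_vector_mul_assoc matrix_vector_mul_lid)
  obtain e where e: "e \<noteq> 0" "\<And>w. w \<bullet> (A *v e) = 0 \<Longrightarrow> w \<noteq> 0 \<Longrightarrow> w \<bullet> (A *v w) > 0"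
    using index_le_1_imp_positive_complement[OF symA detA] index by (metis A_def)
  define S where "S x = hessian_at \<phi> x - A" for x
  have symS: "transpose (S x) = S x" for x
    using symA transpose_hessian_at[of \<phi> x] by (simp add: S_def transpose_def vec_eq_iff)
  have card: "CARD('n) * k = (CARD('n) - 1) * k + k" and k_le: "k \<le> CARD('n) * k"
    by (simp_all add: diff_mult_distrib)
  have pencil: "det (\<chi> i j. A $ i $ j + t * S x $ i $ j) = det A" for x t
  proof -
    obtain R :: "real poly ^ 'n ^ 'n" where R: "\<And>i j. degree (R $ i $ j) \<le> k"
      "\<And>r i j. hessian_at \<phi> (r *\<^sub>R x) $ i $ j = A $ i $ j + r ^ (d - k - 2) * poly (R $ i $ j) r"
      using hessian_at_scaleR_gap[of \<phi> d k x, OF gap] d k_le unfolding A_def by auto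
    have "det (\<chi> i j. A $ i $ j + t * poly (R $ i $ j) 1) = det A"
    proof (rule det_pencil_constant[OF R(1)])
      show "(CARD('n) - 1) * k < d - k - 2"
        using d card by linarith
      show "det (\<chi> i j. A $ i $ j + r ^ (d - k - 2) * poly (R $ i $ j) r) = det A" for r
      proof -
        have "(\<chi> i j. A $ i $ j + r ^ (d - k - 2) * poly (R $ i $ j) r) = hessian_at \<phi> (r *\<^sub>R x)"
          by (simp add: vec_eq_iff R(2))
        then show ?thesis
          using det[of "r *\<^sub>R x"] det[of 0] by (simp only: A_def)
      qed
    qed
    then show ?thesis
      using R(2)[of 1] by (simp add: S_def)
  qed
  define g where "g p q = p \<bullet> (A *v q)" for p q
  have gB: "g (B *v p) q = p \<bullet> q" for p q
    unfolding g_def symmetric_inner_swap[OF symA] AB ..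
  interpret nilpotent_field g e "\<lambda>x p. B *v (S x *v p)" "\<lambda>x w p. B *v (hessian_deriv_at \<phi> x w *v p)"
  proof (intro nilpotent_field.intro lorentz_form.intro nilpotent_field_axioms.intro)
    show "bilinear g"
      unfolding g_def bilinear_def
      by (auto intro!: linearI simp: inner_simps matrix_vector_right_distrib matrix_vector_mult_scaleR)
    show "g p q = g q p" for p q
      unfolding g_def symmetric_inner_swap[OF symA, of p q] by (rule inner_commute)
    show "p = 0" if "\<And>q. g p q = 0" for p
      using that[of "B *v p"] by (simp add: g_def AB)
    show "g w w > 0" if "g w e = 0" "w \<noteq> 0" for w
      using e(2)[of w] that by (simp add: g_def)
    show "linear (\<lambda>p. B *v (S x *v p))" for x
      unfolding matrix_vector_mul_assoc by (rule matrix_vector_mul_linear)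
    show "g (B *v (S x *v p)) q = g p (B *v (S x *v q))" for x p q
      unfolding gB by (simp add: g_def AB symmetric_inner_swap[OF symS])
    show "\<exists>l. ((\<lambda>p. B *v (S x *v p)) ^^ l) p = 0" for x p
      by (rule nilpotent_of_det_pencil_constant[OF detA B(1) pencil])
    have "polynomial_function (\<lambda>x. S x *v p)" for p
      by (rule polynomial_function_matrix_mult)
        (auto simp: S_def hessian_at_nth intro!: real_polynomial_function_diff
          real_polynomial_function.intros(2) real_polynomial_function_eval_rpoly)
    then show "polynomial_function (\<lambda>x. B *v (S x *v p))" for p
      by (rule polynomial_function_matrix_const_mult)
    have "polynomial_function (\<lambda>x. hessian_deriv_at \<phi> x w *v p)" for w p
      by (rule polynomial_function_matrix_mult)
        (auto simp: hessian_deriv_at_def intro!: real_polynomial_function_sum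
          real_polynomial_function.intros(2,4) real_polynomial_function_eval_rpoly)
    then show "polynomial_function (\<lambda>x. B *v (hessian_deriv_at \<phi> x w *v p))" for w p
      by (rule polynomial_function_matrix_const_mult)
    have "((\<lambda>x. S x *v p) has_derivative (\<lambda>w. hessian_deriv_at \<phi> x w *v p)) (at x)" for x p
      using has_derivative_diff[OF has_derivative_hessian_at_mult has_derivative_const[of "A *v p"]]
      by (simp add: S_def matrix_vector_mult_diff_rdistrib)
    then show "((\<lambda>x. B *v (S x *v p)) has_derivative (\<lambda>w. B *v (hessian_deriv_at \<phi> x w *v p))) (at x)" for x p
      by (rule bounded_linear.has_derivative[OF matrix_vector_mul_bounded_linear])
    show "B *v (hessian_deriv_at \<phi> x w *v p) = B *v (hessian_deriv_at \<phi> x p *v w)" for x w p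
      by (simp add: hessian_deriv_at_commute[of \<phi> x w p])
  qed
  obtain \<xi> where \<xi>: "\<xi> \<noteq> 0" "\<And>x. g (B *v (S x *v \<xi>)) \<xi> = 0"
    using null_direction_exists[OF e(1)] by blast
  have "(hessian_at \<phi> x *v \<xi>) \<bullet> \<xi> = (A *v \<xi>) \<bullet> \<xi>" for x
    using \<xi>(2)[of x] by (simp add: gB S_def matrix_vector_mult_diff_rdistrib inner_diff_left)
  then show ?thesis
    using \<xi>(1) unfolding constant_pivot_def by blast
qed

theorem theorem5p13:
  fixes \<phi> :: "4 rpoly" and d k :: nat
  assumes "unimodular_hessian_potential \<phi> 1"
    and "d \<ge> 4 * k + 3"
    and "\<phi> = (\<Sum>j = d - k..d. hom_piece j \<phi>)
             + hom_piece 2 \<phi> + hom_piece 1 \<phi> + hom_piece 0 \<phi>"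
  shows "\<exists>\<xi>. constant_pivot \<phi> \<xi>"
proof -
  have "det (hessian_at \<phi> x) = eval_rpoly (det (hessian \<phi>)) x" for x
    unfolding hessian_at_def
    by (rule det_ring_hom[symmetric]) (rule eval_rpoly_add eval_rpoly_mult eval_rpoly_1)+
  moreover have "eval_rpoly (- 1) x = - 1" for x :: "real ^ 4"
    using eval_rpoly_add[of "- 1" 1 x] by (simp add: eval_rpoly_1)
  ultimately obtain \<delta> where "\<And>x. det (hessian_at \<phi> x) = \<delta>" "\<delta> \<noteq> 0"
    using assms(1) unfolding unimodular_hessian_potential_def
    by (metis eval_rpoly_1 neg_equal_0_iff_equal one_neq_zero)
  moreover have "total_deg m \<le> 2 \<or> total_deg m \<in> {d - k..d}" if "m \<in> Poly_Mapping.keys \<phi>" for m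
  proof (rule ccontr)
    assume m: "\<not> (total_deg m \<le> 2 \<or> total_deg m \<in> {d - k..d})"
    have "Poly_Mapping.lookup \<phi> m = 0"
      by (subst assms(3)) (use m in \<open>auto simp: lookup_add lookup_sum lookup_hom_piece\<close>)
    with that show False
      by (simp add: in_keys_iff)
  qed
  ultimately show ?thesis
    using assms(1,2) unfolding unimodular_hessian_potential_def
    by (intro constant_pivot_of_gap[of \<phi> \<delta> d k]) auto
qed

end
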